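(* Let $p\ge 1$ be an integer and let $\boldsymbol{\beta}=(\beta_0,\ldots,\beta_{p-1})$ be a $p$-tuple of real numbers greater than $1$. The map $$\psi_{\boldsymbol{\beta}}\colon\{0,\ldots,p-1\}\times[0,1)\to\bigcup_{i=0}^{p-1}(\{i\}\times S_{\boldsymbol{\beta}^{(i)}}),\quad(i,x)\mapsto(i,d_{\boldsymbol{\beta}^{(i)}}(x))$$ defines an isomorphism between the dynamical systems $$\big(\{0,\ldots,p-1\}\times[0,1),\mathcal{T}_p,\mu_{\boldsymbol{\beta}},T_{\boldsymbol{\beta}}\big)\quad\text{and}\quad\Big(\bigcup_{i=0}^{p-1}(\{i\}\times S_{\boldsymbol{\beta}^{(i)}}),\mathcal{G}_{\boldsymbol{\beta}},\mu_{\boldsymbol{\beta}}\circ\psi_{\boldsymbol{\beta}}^{-1},\sigma_p\Big).$$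
   Context: Conventions: for $n\in\mathbb{Z}$, $\beta_n=\beta_{n\bmod p}$ and $\boldsymbol{\beta}^{(n)}=(\beta_n,\ldots,\beta_{n+p-1})$. For a real $\beta>1$, $T_\beta\colon[0,1)\to[0,1)$, $x\mapsto \beta x-\lfloor\beta x\rfloor$, and $T_{\boldsymbol{\beta}}(i,x)=((i+1)\bmod p,\,T_{\beta_i}(x))$ on $\{0,\ldots,p-1\}\times[0,1)$. For $x\in[0,1)$, the greedy $\boldsymbol{\beta}$-expansion $d_{\boldsymbol{\beta}}(x)$ is the sequence $a_0a_1a_2\cdots$ with $a_n=\lfloor\beta_n\,(T_{\beta_{n-1}}\circ\cdots\circ T_{\beta_0}(x))\rfloor$; $d_{\boldsymbol{\beta}^{(i)}}$ is defined likewise with base $\boldsymbol{\beta}^{(i)}$. Let $A_{\boldsymbol{\beta}}=\{0,\ldots,\max_{0\le i\le p-1}\lceil\beta_i\rceil-1\}$, $D_{\boldsymbol{\beta}}=\{d_{\boldsymbol{\beta}}(x)\colon x\in[0,1)\}\subset A_{\boldsymbol{\beta}}^{\mathbb{N}}$, and let $S_{\boldsymbol{\beta}}$ be the topological closure of $D_{\boldsymbol{\beta}}$ for the prefix distance (i.e. the product topology of the discrete topology). $\sigma$ is the shift $a_0a_1a_2\cdots\mapsto a_1a_2a_3\cdots$; it is known that $w\in S_{\boldsymbol{\beta}^{(n)}}$ implies $\sigma(w)\in S_{\boldsymbol{\beta}^{(n+1)}}$, so $\sigma_p\colon\bigcup_{i}(\{i\}\times S_{\boldsymbol{\beta}^{(i)}})\to\bigcup_{i}(\{i\}\times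 S_{\boldsymbol{\beta}^{(i)}})$, $(i,w)\mapsto((i+1)\bmod p,\sigma(w))$ is well defined. $\mathcal{C}_{A_{\boldsymbol{\beta}}}$ is the $\sigma$-algebra on $A_{\boldsymbol{\beta}}^{\mathbb{N}}$ generated by the cylinders, and $\mathcal{G}_{\boldsymbol{\beta}}$ is the $\sigma$-algebra of all sets $\bigcup_{i=0}^{p-1}(\{i\}\times(C_i\cap S_{\boldsymbol{\beta}^{(i)}}))$ with $C_i\in\mathcal{C}_{A_{\boldsymbol{\beta}}}$. $\mathcal{T}_p$ is the $\sigma$-algebra of all sets $\bigcup_{i=0}^{p-1}(\{i\}\times B_i)$ with $B_i$ Borel subsets of $[0,1)$. For $i\in\{0,\ldots,p-1\}$, $\mu_{\boldsymbol{\beta},i}$ is the unique absolutely continuous (w.r.t. Lebesgue measure) Borel probability measure on $[0,1)$ invariant under $T_{\beta_{i-1}}\circ\cdots\circ T_{\beta_{i-p}}$ (existence and uniqueness hold), and $\mu_{\boldsymbol{\beta}}\big(\bigcup_{i}(\{i\}\times B_i)\big)=\frac1p\sum_{i=0}^{p-1}\mu_{\boldsymbol{\beta},i}(B_i)$, which is a $T_{\boldsymbol{\beta}}$-invariant probability measure. Two dynamical systems $(X,\mathcal{F}_X,\mu_X,T_X)$ and $(Y,\mathcal{F}_Y,\mu_Y,T_Y)$ (probability spaces with measure preserving transformations) are isomorphic via $\psi$ if $\psi\colon X\to Y$ is a $\mu_X$-a.e. injective measurable map with $\mu_Y=\mu_X\circ\psi^{-1}$ and $\psi\circ T_X=T_Y\circ\psi$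 $\mu_X$-a.e. *)

theory Defs
  imports "HOL-Analysis.Analysis"
begin

section \<open>Measure-preserving dynamical systems\<close>

definition dynamical_system :: "'a measure \<Rightarrow> ('a \<Rightarrow> 'a) \<Rightarrow> bool" where
  "dynamical_system M T \<longleftrightarrow> emeasure M (space M) = 1 \<and> T \<in> M \<rightarrow>\<^sub>M M \<and> distr M M T = M"

definition isomorphic_via ::
    "('a \<Rightarrow> 'b) \<Rightarrow> 'a measure \<Rightarrow> ('a \<Rightarrow> 'a) \<Rightarrow> 'b measure \<Rightarrow> ('b \<Rightarrow> 'b) \<Rightarrow> bool" where
  "isomorphic_via \<psi> M T N S \<longleftrightarrow>
     dynamical_system M T \<and> dynamical_system N S \<and>
     \<psi> \<in> M \<rightarrow>\<^sub>M N \<and>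
     (\<exists>Z \<in> null_sets M. inj_on \<psi> (space M - Z)) \<and>
     N = distr M N \<psi> \<and>
     (AE x in M. \<psi> (T x) = S (\<psi> x))"


section \<open>Alternate bases\<close>

text \<open>An alternate base is a nonempty list of reals greater than 1; its period is the length
  of the list, and indices are extended periodically to all integers.\<close>

definition base_at :: "real list \<Rightarrow> int \<Rightarrow> real" where
  "base_at \<beta> n = \<beta> ! nat (n mod int (length \<beta>))"

definition base_shift :: "real list \<Rightarrow> int \<Rightarrow> real list" where
  "base_shift \<beta> n = map (\<lambda>k. base_at \<beta> (n + int k)) [0..<length \<beta>]"

definition beta_map :: "real \<Rightarrow> real \<Rightarrow> real" where
  "beta_map b x = b * x - of_int \<lfloor>b * x\<rfloor>"

text \<open>\<open>beta_comp \<beta> m n\<close> is the composition of the \<open>n\<close> maps with bases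
  \<open>base_at \<beta> m, \<dots>, base_at \<beta> (m + n - 1)\<close>, the one with index \<open>m\<close> being applied first.\<close>

primrec beta_comp :: "real list \<Rightarrow> int \<Rightarrow> nat \<Rightarrow> real \<Rightarrow> real" where
  "beta_comp \<beta> m 0 x = x"
| "beta_comp \<beta> m (Suc n) x = beta_map (base_at \<beta> (m + int n)) (beta_comp \<beta> m n x)"

definition alt_map :: "real list \<Rightarrow> nat \<times> real \<Rightarrow> nat \<times> real" where
  "alt_map \<beta> = (\<lambda>(i, x). ((i + 1) mod length \<beta>, beta_map (base_at \<beta> (int i)) x))"


section \<open>Greedy expansions and the shift\<close>

definition greedy :: "real list \<Rightarrow> real \<Rightarrow> nat \<Rightarrow> int" where
  "greedy \<beta> x n = \<lfloor>base_at \<beta> (int n) * beta_comp \<beta> 0 n x\<rfloor>"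

definition alphabet :: "real list \<Rightarrow> int set" where
  "alphabet \<beta> = {0 .. Max ((\<lambda>i. \<lceil>\<beta> ! i\<rceil>) ` {..<length \<beta>}) - 1}"

definition greedy_set :: "real list \<Rightarrow> (nat \<Rightarrow> int) set" where
  "greedy_set \<beta> = greedy \<beta> ` {0..<1}"

definition beta_shift_space :: "real list \<Rightarrow> (nat \<Rightarrow> int) set" where
  "beta_shift_space \<beta> =
     product_topology (\<lambda>_. discrete_topology (alphabet \<beta>)) UNIV closure_of greedy_set \<beta>"

definition cylinder :: "int set \<Rightarrow> int list \<Rightarrow> (nat \<Rightarrow> int) set" where
  "cylinder A u = {w \<in> UNIV \<rightarrow> A. \<forall>k < length u. w k = u ! k}"

definition cylinder_algebra :: "int set \<Rightarrow> (nat \<Rightarrow> int) set set" where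
  "cylinder_algebra A = sigma_sets (UNIV \<rightarrow> A) (cylinder A ` lists A)"

definition alt_shift_space :: "real list \<Rightarrow> (nat \<times> (nat \<Rightarrow> int)) set" where
  "alt_shift_space \<beta> = (\<Union>i<length \<beta>. {i} \<times> beta_shift_space (base_shift \<beta> (int i)))"

definition alt_shift_algebra :: "real list \<Rightarrow> (nat \<times> (nat \<Rightarrow> int)) set set" where
  "alt_shift_algebra \<beta> =
     {\<Union>i<length \<beta>. {i} \<times> (C i \<inter> beta_shift_space (base_shift \<beta> (int i))) | C.
        \<forall>i<length \<beta>. C i \<in> cylinder_algebra (alphabet \<beta>)}"

definition alt_shift :: "nat \<Rightarrow> nat \<times> (nat \<Rightarrow> int) \<Rightarrow> nat \<times> (nat \<Rightarrow> int)" where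
  "alt_shift p = (\<lambda>(i, w). ((i + 1) mod p, \<lambda>n. w (Suc n)))"

definition alt_psi :: "real list \<Rightarrow> nat \<times> real \<Rightarrow> nat \<times> (nat \<Rightarrow> int)" where
  "alt_psi \<beta> = (\<lambda>(i, x). (i, greedy (base_shift \<beta> (int i)) x))"


section \<open>The measures\<close>

definition unit_borel :: "real measure" where
  "unit_borel = restrict_space borel {0..<1}"

definition ac_invariant :: "(real \<Rightarrow> real) \<Rightarrow> real measure \<Rightarrow> bool" where
  "ac_invariant f \<mu> \<longleftrightarrow>
     sets \<mu> = sets unit_borel \<and>
     absolutely_continuous (restrict_space lborel {0..<1}) \<mu> \<and>
     dynamical_system \<mu> f"

definition component_measure :: "real list \<Rightarrow> nat \<Rightarrow> real measure" where
  "component_measure \<beta> i =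
     (THE \<mu>. ac_invariant (beta_comp \<beta> (int i - int (length \<beta>)) (length \<beta>)) \<mu>)"

definition alt_algebra :: "nat \<Rightarrow> (nat \<times> real) set set" where
  "alt_algebra p = {\<Union>i<p. {i} \<times> B i | B. \<forall>i<p. B i \<in> sets unit_borel}"

text \<open>\<open>alt_algebra p\<close> and \<open>alt_shift_algebra \<beta>\<close> are already sigma-algebras, so passing to
  the generated sigma-algebra in \<open>measure_of\<close> and \<open>sigma\<close> adds no further sets.\<close>

definition alt_measure :: "real list \<Rightarrow> (nat \<times> real) measure" where
  "alt_measure \<beta> =
     measure_of ({..<length \<beta>} \<times> {0..<1}) (alt_algebra (length \<beta>))
       (\<lambda>E. (\<Sum>i<length \<beta>. emeasure (component_measure \<beta> i) {x. (i, x) \<in> E})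
             / of_nat (length \<beta>))"

definition alt_shift_measure :: "real list \<Rightarrow> (nat \<times> (nat \<Rightarrow> int)) measure" where
  "alt_shift_measure \<beta> =
     distr (alt_measure \<beta>) (sigma (alt_shift_space \<beta>) (alt_shift_algebra \<beta>)) (alt_psi \<beta>)"

end

theory Submission
  imports Defs
begin

text \<open>
  The greedy expansion map intertwines the two transformations and is injective, since two orbits
  with the same digits separate exponentially. The substance is that each composition of
  \<open>\<beta>\<close>-transformations has a unique absolutely continuous invariant probability measure, which is
  what gives the definite description in \<^const>\<open>component_measure\<close> its meaning.

  Every inverse branch of \<open>T\<^sub>b\<close> has the form \<open>y \<mapsto> (y + k) / b\<close>, and a density on \<open>[0, 1)\<close> may be
  extended by \<open>0\<close>, so the transfer operator preserves decreasing densities. On these it satisfies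
  \<open>P h 0 \<le> h 0 / b + 1\<close>, and it spreads the mass near \<open>0\<close> over all of \<open>[0, 1)\<close>. Hence some iterate
  is \<open>\<epsilon> + (1 - \<epsilon>) f'\<close> with \<open>f'\<close> again a decreasing density with the same bound, and any two orbits
  of decreasing densities approach each other uniformly and exponentially fast. The limit along
  starting times going to \<open>-\<infinity>\<close> is the invariant density. Uniqueness follows because
  \<open>\<lambda>(E \<inter> T\<^sup>-\<^sup>n A) \<longlongrightarrow> \<lambda>(E) \<mu>(A)\<close>, first for intervals \<open>E = [0, c)\<close>, then for all Borel sets; applied to
  simple functions below the density of an invariant \<open>\<nu>\<close> this gives \<open>\<nu> \<ge> \<mu>\<close>, so \<open>\<nu> = \<mu>\<close>.
\<close>

section \<open>Transfer operators and decreasing densities\<close>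

text \<open>The transfer operator of \<open>beta_map b\<close> for densities vanishing outside [0,
  1). When \<open>b\<close> is not an integer the last of the \<open>nat \<lceil>b\<rceil>\<close>
  branches is incomplete; points \<open>(y + real k) / b\<close> beyond 1 then contribute 0 because
  \<open>h\<close> vanishes there.\<close>

definition transfer :: "real \<Rightarrow> (real \<Rightarrow> real) \<Rightarrow> real \<Rightarrow> real" where
  "transfer b h y = (if y \<in> {0..<1} then (\<Sum>k<nat \<lceil>b\<rceil>. h ((y + real k) / b)) / b else 0)"

primrec transfer_comp :: "real list \<Rightarrow> int \<Rightarrow> nat \<Rightarrow> (real \<Rightarrow> real) \<Rightarrow> real \<Rightarrow> real" where
  "transfer_comp \<beta> m 0 h = h"
| "transfer_comp \<beta> m (Suc n) h = transfer (base_at \<beta> (m + int n)) (transfer_comp \<beta> m n h)"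

text \<open>Monotonicity is stated on all of [0, \<infinity>) so that it applies directly to branch
  points beyond 1. It makes \<open>h 0\<close> the supremum, so \<open>M\<close> bounds
  \<open>h\<close> everywhere.\<close>

definition dec_density :: "real \<Rightarrow> (real \<Rightarrow> real) \<Rightarrow> bool" where
  "dec_density M h \<longleftrightarrow>
     (\<forall>x. 0 \<le> h x) \<and> (\<forall>x y. 0 \<le> x \<longrightarrow> x \<le> y \<longrightarrow> h y \<le> h x) \<and>
     (\<forall>x. x \<notin> {0..<1} \<longrightarrow> h x = 0) \<and> has_bochner_integral lborel h 1 \<and> h 0 \<le> M"

lemma dec_densityD:
  assumes "dec_density M h"
  shows "0 \<le> h x" "0 \<le> x \<Longrightarrow> x \<le> y \<Longrightarrow> h y \<le> h x" "x \<notin> {0..<1} \<Longrightarrow> h x = 0"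
    "has_bochner_integral lborel h 1" "h 0 \<le> M" "h x \<le> M"
proof -
  show "0 \<le> h x" "0 \<le> x \<Longrightarrow> x \<le> y \<Longrightarrow> h y \<le> h x" "x \<notin> {0..<1} \<Longrightarrow> h x = 0"
    "has_bochner_integral lborel h 1" "h 0 \<le> M"
    using assms by (auto simp: dec_density_def)
  have "0 \<le> h 0" "x \<notin> {0..<1} \<Longrightarrow> h x = 0" "0 \<le> x \<Longrightarrow> h x \<le> h 0"
    using assms by (auto simp: dec_density_def)
  then show "h x \<le> M"
    using \<open>h 0 \<le> M\<close> by (cases "0 \<le> x") auto
qed

lemma dec_density_measurable: "dec_density M h \<Longrightarrow> h \<in> borel_measurable borel"
  using dec_densityD(4) borel_measurable_has_bochner_integral by fastforce

lemma dec_density_nn_integral: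
  assumes "dec_density M h"
  shows "(\<integral>\<^sup>+x. ennreal (h x) \<partial>lborel) = 1"
proof -
  have "(\<integral>\<^sup>+x. ennreal (h x) \<partial>lborel) = ennreal (integral\<^sup>L lborel h)"
    using assms dec_densityD[OF assms]
    by (intro nn_integral_eq_integral) (auto simp: has_bochner_integral_iff)
  then show ?thesis
    using dec_densityD(4)[OF assms] by (simp add: has_bochner_integral_iff)
qed

lemma dec_densityI:
  assumes "\<And>x. 0 \<le> h x" "\<And>x y. 0 \<le> x \<Longrightarrow> x \<le> y \<Longrightarrow> y < 1 \<Longrightarrow> h y \<le> h x"
    "\<And>x. x \<notin> {0..<1} \<Longrightarrow> h x = 0" "h \<in> borel_measurable borel"
    "(\<integral>\<^sup>+x. ennreal (h x) \<partial>lborel) = 1" "h 0 \<le> M"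
  shows "dec_density M h"
proof -
  have "has_bochner_integral lborel h 1"
    by (rule has_bochner_integral_nn_integral) (use assms in auto)
  moreover have "h y \<le> h x" if "0 \<le> x" "x \<le> y" for x y
    using assms(1,2,3)[of x] assms(2)[of x y] assms(3)[of y] that by (cases "y < 1") auto
  ultimately show ?thesis
    using assms by (auto simp: dec_density_def)
qed

lemma beta_map_measurable [measurable]: "beta_map b \<in> borel_measurable borel"
  unfolding beta_map_def by measurable

lemma beta_comp_measurable [measurable]: "beta_comp \<beta> m n \<in> borel_measurable borel"
  by (induction n) (auto intro!: measurable_compose[OF _ beta_map_measurable])

lemma transfer_measurable [measurable]:
  assumes [measurable]: "h \<in> borel_measurable borel"
  shows "transfer b h \<in> borel_measurable borel"
  unfolding transfer_def by measurable

lemma transfer_comp_measurable [measurable]: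
  "h \<in> borel_measurable borel \<Longrightarrow> transfer_comp \<beta> m n h \<in> borel_measurable borel"
  by (induction n) auto

lemma transfer_nonneg: "b > 0 \<Longrightarrow> (\<And>x. 0 \<le> h x) \<Longrightarrow> 0 \<le> transfer b h y"
  by (auto simp: transfer_def intro!: divide_nonneg_nonneg sum_nonneg)

text \<open>Substituting \<open>x = (y + k) / b\<close> on the \<open>k\<close>-th branch of the \<open>b\<close>-transformation.\<close>

lemma nn_integral_transfer:
  fixes u :: "real \<Rightarrow> ennreal"
  assumes b: "b > 0" and [measurable]: "h \<in> borel_measurable borel" "u \<in> borel_measurable borel"
    and h: "\<And>x. 0 \<le> h x" "\<And>x. x \<notin> {0..<1} \<Longrightarrow> h x = 0"
  shows "(\<integral>\<^sup>+x. u (beta_map b x) * h x \<partial>lborel) = (\<integral>\<^sup>+y. u y * transfer b h y \<partial>lborel)"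
proof -
  let ?I = "indicator {0..<1} :: real \<Rightarrow> ennreal"
  let ?N = "nat \<lceil>b\<rceil>"
  \<comment> \<open>The factor \<open>?I (b * x - k)\<close> selects the single branch
    \<open>k = \<lfloor>b * x\<rfloor>\<close>, so that each summand can be treated by its own
    affine substitution.\<close>
  have split: "u (beta_map b x) * h x = (\<Sum>k<?N. u (b * x - k) * h x * ?I (b * x - k))" for x
  proof (cases "x \<in> {0..<1}")
    case False
    then show ?thesis using h(2) by simp
  next
    case True
    define j where "j = nat \<lfloor>b * x\<rfloor>"
    have j0: "0 \<le> \<lfloor>b * x\<rfloor>" using True b by auto
    have "b * x < b" using True b by auto
    then have "b * x < \<lceil>b\<rceil>" by linarith
    then have "\<lfloor>b * x\<rfloor> < \<lceil>b\<rceil>" by linarith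
    then have jN: "j < ?N" using j0 unfolding j_def by linarith
    have rj: "real j = of_int \<lfloor>b * x\<rfloor>" using j0 by (simp add: j_def)
    have ind: "?I (b * x - real k) = (if k = j then 1 else 0)" for k :: nat
    proof (cases "k = j")
      case True
      then show ?thesis using rj by (auto simp: indicator_def) linarith+
    next
      case False
      have "\<lfloor>b * x\<rfloor> = int k" if "0 \<le> b * x - real k" "b * x - real k < 1"
        using that by linarith
      with False have "\<not> (0 \<le> b * x - real k \<and> b * x - real k < 1)"
        unfolding j_def by auto
      then show ?thesis using False by (auto simp: indicator_def)
    qed
    have "(\<Sum>k<?N. u (b * x - k) * h x * ?I (b * x - k))
        = (\<Sum>k<?N. if k = j then u (b * x - j) * h x else 0)"
      by (intro sum.cong refl) (auto simp: ind)
    also have "\<dots> = u (b * x - j) * h x" using jN by simp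
    finally show ?thesis using rj by (simp add: beta_map_def)
  qed
  have branch: "(\<integral>\<^sup>+x. u (b * x - real k) * h x * ?I (b * x - real k) \<partial>lborel)
      = (\<integral>\<^sup>+y. u y * ennreal (h ((y + real k) / b) / b) * ?I y \<partial>lborel)" for k :: nat
  proof -
    have e: "b * (real k / b + 1 / b * y) - real k = y" "real k / b + 1 / b * y = (y + real k) / b" for y
      using b by (auto simp: field_simps)
    have "(\<integral>\<^sup>+x. u (b * x - real k) * h x * ?I (b * x - real k) \<partial>lborel)
        = ennreal \<bar>1 / b\<bar> * (\<integral>\<^sup>+y. u y * h ((y + real k) / b) * ?I y \<partial>lborel)"
      using b by (subst nn_integral_real_affine[where c = "1 / b" and t = "real k / b"])
        (simp_all only: e, auto)
    also have "\<dots> = (\<integral>\<^sup>+y. ennreal \<bar>1 / b\<bar> * (u y * h ((y + real k) / b) * ?I y) \<partial>lborel)"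
      by (rule nn_integral_cmult[symmetric]) measurable
    also have "\<dots> = (\<integral>\<^sup>+y. u y * ennreal (h ((y + real k) / b) / b) * ?I y \<partial>lborel)"
      using b h(1) by (intro nn_integral_cong)
        (auto simp: divide_inverse ennreal_mult' ac_simps)
    finally show ?thesis .
  qed
  have "(\<integral>\<^sup>+x. u (beta_map b x) * h x \<partial>lborel)
      = (\<Sum>k<?N. \<integral>\<^sup>+x. u (b * x - real k) * h x * ?I (b * x - real k) \<partial>lborel)"
    unfolding split by (rule nn_integral_sum) measurable
  also have "\<dots> = (\<integral>\<^sup>+y. (\<Sum>k<?N. u y * ennreal (h ((y + real k) / b) / b) * ?I y) \<partial>lborel)"
    unfolding branch by (rule nn_integral_sum[symmetric]) measurable
  also have "\<dots> = (\<integral>\<^sup>+y. u y * transfer b h y \<partial>lborel)"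
  proof (rule nn_integral_cong)
    fix y
    have "(\<Sum>k<?N. ennreal (h ((y + real k) / b) / b)) = ennreal ((\<Sum>k<?N. h ((y + real k) / b)) / b)"
      using b h(1) by (simp add: sum_divide_distrib sum_ennreal)
    then show "(\<Sum>k<?N. u y * ennreal (h ((y + real k) / b) / b) * ?I y) = u y * transfer b h y"
      by (auto simp: transfer_def sum_distrib_left[symmetric] indicator_def)
  qed
  finally show ?thesis .
qed

lemma transfer_antimono:
  assumes "b > 0" "\<And>x y. 0 \<le> x \<Longrightarrow> x \<le> y \<Longrightarrow> h y \<le> h x" "0 \<le> x" "x \<le> y" "y < 1"
  shows "transfer b h y \<le> transfer b h x"
proof -
  have "h ((y + real k) / b) \<le> h ((x + real k) / b)" for k
    using assms by (intro assms(2) divide_right_mono) auto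
  then show ?thesis
    using assms by (auto simp: transfer_def intro!: divide_right_mono sum_mono)
qed

text \<open>By monotonicity, shifting the summation index by one turns \<open>transfer b h 0\<close> into a lower
  bound for every \<open>transfer b h y\<close>; integrating over \<open>y\<close> gives the claim.\<close>

lemma transfer_at_0:
  assumes b: "b > 1" and h: "dec_density M h"
  shows "transfer b h 0 \<le> h 0 / b + 1"
proof -
  note [measurable] = dec_density_measurable[OF h]
  let ?c = "transfer b h 0 - h 0 / b"
  obtain N where N: "nat \<lceil>b\<rceil> = Suc N" using b by (cases "nat \<lceil>b\<rceil>") auto
  have le: "?c \<le> transfer b h y" if "y \<in> {0..<1}" for y
  proof -
    have "(\<Sum>k<Suc N. h (real k / b)) = h 0 + (\<Sum>k<N. h (real (Suc k) / b))"
      by (subst sum.lessThan_Suc_shift) simp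
    also have "(\<Sum>k<N. h (real (Suc k) / b)) \<le> (\<Sum>k<N. h ((y + real k) / b))"
      using that b by (intro sum_mono dec_densityD(2)[OF h] divide_right_mono) auto
    also have "\<dots> \<le> (\<Sum>k<Suc N. h ((y + real k) / b))"
      using dec_densityD(1)[OF h] by simp
    finally have "(\<Sum>k<Suc N. h (real k / b)) / b \<le> (h 0 + (\<Sum>k<Suc N. h ((y + real k) / b))) / b"
      using b by (intro divide_right_mono) auto
    then show ?thesis
      using that N by (simp add: transfer_def add_divide_distrib)
  qed
  have "ennreal ?c = (\<integral>\<^sup>+y. ennreal ?c * indicator {0..<1::real} y \<partial>lborel)"
    by (simp add: nn_integral_cmult_indicator)
  also have "\<dots> \<le> (\<integral>\<^sup>+y. 1 * ennreal (transfer b h y) \<partial>lborel)"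
    using le by (intro nn_integral_mono) (auto simp: indicator_def intro!: ennreal_leI)
  also have "\<dots> = (\<integral>\<^sup>+y. 1 * ennreal (h y) \<partial>lborel)"
    using b dec_densityD[OF h] by (intro nn_integral_transfer[symmetric]) auto
  also have "\<dots> = 1" using dec_density_nn_integral[OF h] by simp
  finally have "ennreal ?c \<le> ennreal 1" by simp
  then show ?thesis by (subst (asm) ennreal_le_iff) auto
qed

lemma transfer_dec_density:
  assumes b: "b > 1" and h: "dec_density M h"
  shows "dec_density (h 0 / b + 1) (transfer b h)"
proof (rule dec_densityI)
  note [measurable] = dec_density_measurable[OF h]
  show "0 \<le> transfer b h x" for x
    using b dec_densityD[OF h] by (intro transfer_nonneg) auto
  show "transfer b h y \<le> transfer b h x" if "0 \<le> x" "x \<le> y" "y < 1" for x y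
    using b dec_densityD[OF h] that by (intro transfer_antimono) auto
  show "transfer b h x = 0" if "x \<notin> {0..<1}" for x
    using that by (auto simp: transfer_def)
  show "transfer b h \<in> borel_measurable borel" by measurable
  show "(\<integral>\<^sup>+x. ennreal (transfer b h x) \<partial>lborel) = 1"
    using nn_integral_transfer[of b h "\<lambda>_. 1"] b dec_densityD[OF h] dec_density_nn_integral[OF h]
    by simp
  show "transfer b h 0 \<le> h 0 / b + 1"
    by (rule transfer_at_0[OF assms])
qed

text \<open>Only the branch \<open>k = 0\<close>, the point \<open>y / b\<close>, is kept; the other
  terms are nonnegative. A bound \<open>c\<close> near 0 thus spreads to an interval longer by the
  factor \<open>b0\<close>, at the price of \<open>1 / b1\<close>. The uniform bounds
  \<open>b0\<close> and \<open>b1\<close> allow iteration with varying bases.\<close>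

lemma transfer_lower:
  assumes b: "1 < b0" "b0 \<le> b" "b \<le> b1" and h: "\<And>x. 0 \<le> h x" and c: "c \<ge> 0"
    and lo: "\<And>x. 0 \<le> x \<Longrightarrow> x < 1 \<Longrightarrow> x < d \<Longrightarrow> c \<le> h x"
    and y: "0 \<le> y" "y < 1" "y < b0 * d"
  shows "c / b1 \<le> transfer b h y"
proof -
  obtain N where N: "nat \<lceil>b\<rceil> = Suc N" using b by (cases "nat \<lceil>b\<rceil>") auto
  have "y / b \<le> y / b0" using y b by (intro divide_left_mono) auto
  moreover have "y / b0 < d" using y b by (simp add: field_simps)
  moreover have "y / b < 1" using y b by simp
  ultimately have "c \<le> h (y / b)" using y b by (intro lo) auto
  also have "\<dots> \<le> (\<Sum>k<nat \<lceil>b\<rceil>. h ((y + real k) / b))"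
    unfolding N using sum_nonneg[of "{..<N}" "\<lambda>k. h ((y + real (Suc k)) / b)"] h
    by (subst sum.lessThan_Suc_shift) auto
  finally have "c / b \<le> transfer b h y"
    using y b by (auto simp: transfer_def intro!: divide_right_mono)
  moreover have "c / b1 \<le> c / b" using b c by (intro divide_left_mono) auto
  ultimately show ?thesis by simp
qed

text \<open>If \<open>h t\<close> were below 1 / 2, the mass on [0, t) would be at most
  \<open>M * t\<close> and that on [t, 1) at most \<open>(1 - t) / 2\<close> by monotonicity, a
  total below 1.\<close>

lemma dec_density_lower:
  assumes h: "dec_density M h" and t: "0 \<le> t" "t < 1" "2 * M * t < 1"
  shows "1 / 2 \<le> h t"
proof (rule ccontr)
  assume less: "\<not> 1 / 2 \<le> h t"
  have "has_bochner_integral lborel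
      (\<lambda>x. M * indicator {0..<t} x + 1 / 2 * indicator {t..<1} x) (M * t + 1 / 2 * (1 - t))"
    using t has_bochner_integral_real_indicator[of "{0..<t}" lborel]
      has_bochner_integral_real_indicator[of "{t..<1}" lborel]
    by (intro has_bochner_integral_add has_bochner_integral_mult_right) auto
  moreover have "h x \<le> M * indicator {0..<t} x + 1 / 2 * indicator {t..<1} x" for x
    using dec_densityD(1,3,6)[OF h, of x] dec_densityD(2)[OF h, of t x] less t
    by (auto simp: indicator_def)
  ultimately have "1 \<le> M * t + 1 / 2 * (1 - t)"
    using dec_densityD(4)[OF h] integral_mono[of lborel h
        "\<lambda>x. M * indicator {0..<t} x + 1 / 2 * indicator {t..<1} x"]
    unfolding has_bochner_integral_iff by auto
  moreover have "M * t + 1 / 2 * (1 - t) < 1" if "t > 0" using t that by argo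
  moreover have "t = 0 \<Longrightarrow> M * t + 1 / 2 * (1 - t) < 1" by simp
  ultimately show False using t by force
qed

lemma transfer_combine:
  "transfer b (\<lambda>x. c * f x + d * g x) = (\<lambda>y. c * transfer b f y + d * transfer b g y)"
  by (auto simp: transfer_def fun_eq_iff sum.distrib sum_distrib_left add_divide_distrib)

lemma transfer_comp_combine:
  "transfer_comp \<beta> m n (\<lambda>x. c * f x + d * g x)
     = (\<lambda>y. c * transfer_comp \<beta> m n f y + d * transfer_comp \<beta> m n g y)"
  by (induction n) (simp_all add: transfer_combine)

lemma transfer_comp_add:
  "transfer_comp \<beta> m (n + k) h = transfer_comp \<beta> (m + int n) k (transfer_comp \<beta> m n h)"
  by (induction k) (simp_all add: ac_simps)

lemma beta_comp_add: "beta_comp \<beta> m (n + k) x = beta_comp \<beta> (m + int n) k (beta_comp \<beta> m n x)"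
  by (induction k) (simp_all add: ac_simps)

section \<open>Exponential loss of memory and the invariant density\<close>

locale alternate_base =
  fixes \<beta> :: "real list"
  assumes nonempty: "\<beta> \<noteq> []" and gt_1: "\<And>b. b \<in> set \<beta> \<Longrightarrow> 1 < b"
begin

definition lo :: real where "lo = Min (set \<beta>)"
definition hi :: real where "hi = Max (set \<beta>)"
text \<open>The fixed point of \<open>a \<mapsto> a / lo + 1\<close>, the map by which
  \<open>transfer_at_0\<close> controls the value at 0 when the base is at least
  \<open>lo\<close>.\<close>

definition kappa :: real where "kappa = lo / (lo - 1)"

lemma base_at_in: "base_at \<beta> m \<in> set \<beta>"
proof -
  have "nat (m mod int (length \<beta>)) < length \<beta>"
    using nonempty by (simp add: nat_less_iff)
  then show ?thesis by (simp add: base_at_def)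
qed

lemma base_at_bounds:
  "1 < base_at \<beta> m" "lo \<le> base_at \<beta> m" "base_at \<beta> m \<le> hi" "0 < base_at \<beta> m"
  using base_at_in[of m] gt_1[of "base_at \<beta> m"] by (auto simp: lo_def hi_def)

lemma lo_gt_1: "1 < lo"
  using nonempty gt_1 by (simp add: lo_def)

lemma hi_gt_1: "1 < hi"
  using base_at_bounds[of 0] by linarith

lemma kappa_gt_1: "1 < kappa"
  using lo_gt_1 by (simp add: kappa_def field_simps)

lemma kappa_eq: "kappa / lo + 1 = kappa"
  using lo_gt_1 by (simp add: kappa_def field_simps)

text \<open>Iterates \<open>transfer_at_0\<close>: each step divides the value at 0 by at least
  \<open>lo\<close> and adds 1, and the accumulated additions stay within \<open>kappa\<close> by
  \<open>kappa_eq\<close>. The explicit \<open>n\<close> shows how fast the initial height is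
  forgotten.\<close>

lemma transfer_comp_dec_density:
  assumes h: "dec_density M h"
  shows "dec_density (h 0 / lo ^ n + kappa) (transfer_comp \<beta> m n h)"
proof (induction n)
  case 0
  then show ?case using h kappa_gt_1 by (auto simp: dec_density_def)
next
  case (Suc n)
  let ?b = "base_at \<beta> (m + int n)" and ?g = "transfer_comp \<beta> m n h"
  have "dec_density (?g 0 / ?b + 1) (transfer ?b ?g)"
    by (rule transfer_dec_density[OF base_at_bounds(1) Suc])
  moreover have "?g 0 / ?b + 1 \<le> h 0 / lo ^ Suc n + kappa"
  proof -
    have "?g 0 / ?b \<le> ?g 0 / lo"
      using lo_gt_1 base_at_bounds[of "m + int n"] dec_densityD(1)[OF Suc, of 0]
      by (intro divide_left_mono) auto
    also have "\<dots> \<le> (h 0 / lo ^ n + kappa) / lo"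
      using lo_gt_1 dec_densityD(5)[OF Suc] by (intro divide_right_mono) auto
    also have "\<dots> = h 0 / lo ^ Suc n + kappa / lo"
      by (simp add: add_divide_distrib)
    finally show ?thesis using kappa_eq by linarith
  qed
  ultimately show ?case by (auto simp: dec_density_def)
qed

text \<open>Since \<open>M\<close> lies above the fixed point \<open>kappa\<close>, one step leads
  from \<open>M\<close> to \<open>M / lo + 1 \<le> M\<close>. The same bound is reproduced, which
  provides one class of densities stable under all compositions.\<close>

lemma transfer_comp_dec_density':
  assumes M: "4 * kappa \<le> M" and h: "dec_density M h"
  shows "dec_density M (transfer_comp \<beta> m n h)"
proof (induction n)
  case 0
  then show ?case using h by simp
next
  case (Suc n)
  let ?b = "base_at \<beta> (m + int n)" and ?g = "transfer_comp \<beta> m n h"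
  have "dec_density (?g 0 / ?b + 1) (transfer ?b ?g)"
    by (rule transfer_dec_density[OF base_at_bounds(1) Suc])
  moreover have "?g 0 / ?b + 1 \<le> M"
  proof -
    have "?g 0 / ?b \<le> M / lo"
      using lo_gt_1 base_at_bounds[of "m + int n"] dec_densityD(1)[OF Suc, of 0] dec_densityD(5)[OF Suc]
      by (intro frac_le) auto
    moreover have "M / lo + 1 \<le> M"
    proof -
      have "kappa \<le> M" using M kappa_gt_1 by linarith
      then have "lo \<le> M * (lo - 1)" using lo_gt_1 by (simp add: kappa_def field_simps)
      then show ?thesis using lo_gt_1 by (simp add: field_simps)
    qed
    ultimately show ?thesis by linarith
  qed
  ultimately show ?case by (auto simp: dec_density_def)
qed

text \<open>Iterates \<open>transfer_lower\<close>: at each step the interval carrying the bound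
  grows by \<open>lo\<close>, as long as it stays in [0, 1), and the bound shrinks by
  \<open>hi\<close>.\<close>

lemma transfer_comp_lower:
  assumes h: "\<And>x. 0 \<le> h x" and c: "c \<ge> 0"
    and low: "\<And>x. 0 \<le> x \<Longrightarrow> x < 1 \<Longrightarrow> x < d \<Longrightarrow> c \<le> h x"
  shows "0 \<le> y \<Longrightarrow> y < 1 \<Longrightarrow> y < lo ^ n * d \<Longrightarrow> c / hi ^ n \<le> transfer_comp \<beta> m n h y"
proof (induction n arbitrary: y)
  case 0
  then show ?case using low by simp
next
  case (Suc n)
  have nn: "0 \<le> transfer_comp \<beta> m n h x" for x
    using h base_at_bounds(4) by (induction n arbitrary: x) (auto intro!: transfer_nonneg)
  have "c / hi ^ n / hi \<le> transfer (base_at \<beta> (m + int n)) (transfer_comp \<beta> m n h) y"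
    using Suc.prems c hi_gt_1
    by (intro transfer_lower[OF lo_gt_1 base_at_bounds(2,3) nn _ Suc.IH]) (auto simp: ac_simps)
  then show ?case by (simp add: ac_simps)
qed

text \<open>Doeblin condition: after finitely many steps a fixed fraction of the mass is uniformly
  distributed. Removing it keeps the density decreasing.\<close>

lemma doeblin_step:
  assumes M: "4 * kappa \<le> M"
  obtains N \<epsilon> where "0 < \<epsilon>" "\<epsilon> < 1" "0 < N"
    "\<And>m f. dec_density M f \<Longrightarrow>
       \<exists>f'. dec_density M f' \<and>
         transfer_comp \<beta> m N f = (\<lambda>x. \<epsilon> * indicator {0..<1} x + (1 - \<epsilon>) * f' x)"
proof -
  have M4: "4 < M" using M kappa_gt_1 by linarith
  \<comment> \<open>By \<open>dec_density_lower\<close> every density of the class is at least 1 / 2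
    on [0, 1 / (2 * M)). This \<open>N\<close> expands that interval over [0, 1) and also gives
    \<open>f 0 / lo ^ N \<le> 1 / 2\<close>; \<open>\<epsilon>\<close> is the height 1 / 2 after
    \<open>N\<close> divisions by \<open>hi\<close>.\<close>
  obtain N where N: "2 * M < lo ^ N"
    using real_arch_pow[OF lo_gt_1] by blast
  define \<epsilon> where "\<epsilon> = 1 / 2 / hi ^ N"
  have "1 \<le> hi ^ N" using hi_gt_1 by simp
  then have eps: "0 < \<epsilon>" "\<epsilon> \<le> 1 / 2" by (auto simp: \<epsilon>_def field_simps)
  have "N > 0" using N M4 by (cases N) auto
  moreover have "\<exists>f'. dec_density M f' \<and>
       transfer_comp \<beta> m N f = (\<lambda>x. \<epsilon> * indicator {0..<1} x + (1 - \<epsilon>) * f' x)"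
    if f: "dec_density M f" for m f
  proof -
    let ?g = "transfer_comp \<beta> m N f"
    let ?f' = "\<lambda>x. (?g x - \<epsilon> * indicator {0..<1} x) / (1 - \<epsilon>)"
    have g: "dec_density (f 0 / lo ^ N + kappa) ?g"
      by (rule transfer_comp_dec_density[OF f])
    have low: "\<epsilon> \<le> ?g y" if "0 \<le> y" "y < 1" for y
      unfolding \<epsilon>_def
    proof (rule transfer_comp_lower[where d = "1 / (2 * M)"])
      show "1 / 2 \<le> f x" if "0 \<le> x" "x < 1" "x < 1 / (2 * M)" for x
        using that M4 by (intro dec_density_lower[OF f]) (auto simp: field_simps)
      show "y < lo ^ N * (1 / (2 * M))"
      proof -
        have "y * (2 * M) \<le> 1 * (2 * M)"
          using \<open>y < 1\<close> M4 by (intro mult_right_mono) auto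
        then have "y * (2 * M) < lo ^ N" using N by linarith
        then show ?thesis using M4 by (simp add: pos_less_divide_eq)
      qed
    qed (use that dec_densityD(1)[OF f] in auto)
    have "dec_density M ?f'"
      unfolding dec_density_def
    proof (intro conjI allI impI)
      fix x y :: real
      show "0 \<le> ?f' x"
        using low[of x] dec_densityD(1)[OF g, of x] eps by (auto simp: indicator_def)
      show "?f' y \<le> ?f' x" if "0 \<le> x" "x \<le> y"
        using low[of x] dec_densityD(1)[OF g, of x] dec_densityD(3)[OF g, of y]
          dec_densityD(2)[OF g, of x y] eps that
        by (intro divide_right_mono) (auto simp: indicator_def)
      show "?f' x = 0" if "x \<notin> {0..<1}"
        using that dec_densityD(3)[OF g, of x] by auto
      have "has_bochner_integral lborel ?f' ((1 - \<epsilon> * 1) / (1 - \<epsilon>))"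
        using has_bochner_integral_real_indicator[of "{0..<1::real}" lborel]
        by (intro has_bochner_integral_divide_zero has_bochner_integral_diff
            has_bochner_integral_mult_right dec_densityD(4)[OF g]) auto
      then show "has_bochner_integral lborel ?f' 1" using eps by simp
      have "f 0 / lo ^ N \<le> M / (2 * M)"
        using N M4 dec_densityD(1)[OF f, of 0] dec_densityD(5)[OF f] by (intro frac_le) auto
      then have "?g 0 \<le> 1 / 2 + kappa"
      proof -
        have "M / (2 * M) = 1 / 2" using M4 by simp
        with \<open>f 0 / lo ^ N \<le> M / (2 * M)\<close> show ?thesis
          using dec_densityD(5)[OF g] by linarith
      qed
      \<comment> \<open>The factor 4 in the bound on \<open>M\<close> is spent here: half of
        \<open>M\<close> absorbs \<open>1 / 2 + kappa\<close>, and the other half pays for the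
        division by \<open>1 - \<epsilon> \<ge> 1 / 2\<close>.\<close>
      also have "\<dots> \<le> M / 2" using M kappa_gt_1 by linarith
      also have "\<dots> \<le> M * (1 - \<epsilon>)" using eps M4 by (simp add: field_simps)
      finally have "?g 0 - \<epsilon> \<le> M * (1 - \<epsilon>)" using eps by simp
      then show "?f' 0 \<le> M" using eps by (simp add: field_simps)
    qed
    moreover have "?g = (\<lambda>x. \<epsilon> * indicator {0..<1} x + (1 - \<epsilon>) * ?f' x)"
      using eps by auto
    ultimately show ?thesis by blast
  qed
  ultimately show thesis using eps that[of \<epsilon> N] by auto
qed

text \<open>After \<open>N\<close> steps both densities contain the same uniform part of weight
  \<open>\<epsilon>\<close>, which cancels in the difference; the remainders belong to the class
  again and carry the factor \<open>1 - \<epsilon>\<close>. The difference decays like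
  \<open>(1 - \<epsilon>) ^ (n div N) * M\<close>, uniformly in the starting index, the densities
  and the point.\<close>

lemma loss_of_memory:
  assumes M: "4 * kappa \<le> M"
  obtains \<rho> :: "nat \<Rightarrow> real" where "\<rho> \<longlonglongrightarrow> 0"
    "\<And>m n f g y. dec_density M f \<Longrightarrow> dec_density M g \<Longrightarrow>
       \<bar>transfer_comp \<beta> m n f y - transfer_comp \<beta> m n g y\<bar> \<le> \<rho> n"
proof -
  obtain N \<epsilon> where eps: "0 < \<epsilon>" "\<epsilon> < 1" "0 < N" and
    step: "\<And>m f. dec_density M f \<Longrightarrow>
       \<exists>f'. dec_density M f' \<and>
         transfer_comp \<beta> m N f = (\<lambda>x. \<epsilon> * indicator {0..<1} x + (1 - \<epsilon>) * f' x)"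
    by (rule doeblin_step[OF M]) blast
  have mult: "\<bar>transfer_comp \<beta> m (q * N) f y - transfer_comp \<beta> m (q * N) g y\<bar> \<le> (1 - \<epsilon>) ^ q * M"
    if "dec_density M f" "dec_density M g" for q m f g y
    using that
  proof (induction q arbitrary: m f g)
    case 0
    then show ?case
      using dec_densityD(1,6)[of M f y] dec_densityD(1,6)[of M g y] by auto
  next
    case (Suc q)
    obtain f' where f': "dec_density M f'"
      "transfer_comp \<beta> m N f = (\<lambda>x. \<epsilon> * indicator {0..<1} x + (1 - \<epsilon>) * f' x)"
      using step[OF Suc.prems(1)] by blast
    obtain g' where g': "dec_density M g'"
      "transfer_comp \<beta> m N g = (\<lambda>x. \<epsilon> * indicator {0..<1} x + (1 - \<epsilon>) * g' x)"
      using step[OF Suc.prems(2)] by blast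
    let ?P = "transfer_comp \<beta> (m + int N) (q * N)"
    have "transfer_comp \<beta> m (Suc q * N) f y - transfer_comp \<beta> m (Suc q * N) g y
        = (1 - \<epsilon>) * (?P f' y - ?P g' y)"
      by (simp add: transfer_comp_add f' g' transfer_comp_combine right_diff_distrib)
    then show ?case
      using Suc.IH[OF f'(1) g'(1), of "m + int N"] eps by (simp add: abs_mult mult.assoc)
  qed
  define \<rho> where "\<rho> n = (1 - \<epsilon>) ^ (n div N) * M" for n
  show thesis
  proof
    have "filterlim (\<lambda>n. n div N) at_top sequentially"
      unfolding filterlim_at_top
    proof
      fix Z
      show "\<forall>\<^sub>F n in sequentially. Z \<le> n div N"
        using eventually_ge_at_top[of "Z * N"]
        by eventually_elim (use eps in \<open>simp add: less_eq_div_iff_mult_less_eq\<close>)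
    qed
    then have "(\<lambda>n. (1 - \<epsilon>) ^ (n div N)) \<longlonglongrightarrow> 0"
      using eps by (intro filterlim_compose[OF LIMSEQ_realpow_zero]) auto
    then show "\<rho> \<longlonglongrightarrow> 0"
      unfolding \<rho>_def by (rule tendsto_mult_left_zero)
    fix m n f g y
    assume fg: "dec_density M f" "dec_density M g"
    \<comment> \<open>The \<open>n mod N\<close> left-over steps are performed first: they only
      replace the two densities by others of the class, and full blocks of length \<open>N\<close>
      remain.\<close>
    have "n = n mod N + (n div N) * N" by simp
    then have "transfer_comp \<beta> m n h
        = transfer_comp \<beta> (m + int (n mod N)) (n div N * N) (transfer_comp \<beta> m (n mod N) h)" for h
      by (metis transfer_comp_add)
    then show "\<bar>transfer_comp \<beta> m n f y - transfer_comp \<beta> m n g y\<bar> \<le> \<rho> n"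
      using mult[OF fg[THEN transfer_comp_dec_density'[OF M]]] by (simp add: \<rho>_def)
  qed
qed

lemma dec_density_uniform:
  assumes c: "0 < c" "c \<le> 1"
  shows "dec_density (1 / c) (\<lambda>x. indicator {0..<c} x / c)"
  unfolding dec_density_def
proof (intro conjI allI impI)
  have "has_bochner_integral lborel (\<lambda>x. indicator {0..<c} x / c) (c / c)"
    using has_bochner_integral_real_indicator[of "{0..<c}" lborel] c
    by (intro has_bochner_integral_divide_zero) auto
  then show "has_bochner_integral lborel (\<lambda>x. indicator {0..<c} x / c) 1" using c by simp
qed (use c in \<open>auto simp: indicator_def\<close>)

text \<open>A pullback limit: the uniform density is started at time \<open>m - n\<close> and has
  run for \<open>n\<close> steps on arrival at time \<open>m\<close>. The starting time moves, not
  the final one, since the base depends on time.\<close>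

definition invariant_density :: "int \<Rightarrow> real \<Rightarrow> real" where
  "invariant_density m y
     = lim (\<lambda>n. transfer_comp \<beta> (m - int n) n (indicator {0..<1}) y)"

lemma dec_density_indicator: "dec_density (4 * kappa) (indicator {0..<1})"
  using dec_density_uniform[of 1] kappa_gt_1 by (auto simp: dec_density_def)

text \<open>Starting \<open>k\<close> steps earlier amounts to starting at \<open>m - n\<close> with
  another density of the class, so \<open>loss_of_memory\<close> bounds the difference by
  \<open>\<rho> n\<close> for every \<open>k\<close> and the sequence is Cauchy.\<close>

lemma invariant_density_tendsto:
  "(\<lambda>n. transfer_comp \<beta> (m - int n) n (indicator {0..<1}) y) \<longlonglongrightarrow> invariant_density m y"
proof -
  let ?u = "\<lambda>n. transfer_comp \<beta> (m - int n) n (indicator {0..<1}) y"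
  obtain \<rho> :: "nat \<Rightarrow> real" where \<rho>: "\<rho> \<longlonglongrightarrow> 0"
    "\<And>m n f g y. dec_density (4 * kappa) f \<Longrightarrow> dec_density (4 * kappa) g \<Longrightarrow>
       \<bar>transfer_comp \<beta> m n f y - transfer_comp \<beta> m n g y\<bar> \<le> \<rho> n"
    using loss_of_memory[OF order_refl] by blast
  have le: "\<bar>?u (n + k) - ?u n\<bar> \<le> \<rho> n" for n k
  proof -
    have "transfer_comp \<beta> (m - int (k + n)) (k + n) (indicator {0..<1})
      = transfer_comp \<beta> (m - int n) n
          (transfer_comp \<beta> (m - int (k + n)) k (indicator {0..<1}))"
      by (simp add: transfer_comp_add)
    then show ?thesis
      using \<rho>(2)[OF transfer_comp_dec_density'[OF order_refl dec_density_indicator]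
          dec_density_indicator]
      by (simp add: add.commute[of k])
  qed
  have "Cauchy ?u"
  proof (rule metric_CauchyI)
    fix e :: real assume "0 < e"
    then obtain n0 where n0: "\<And>n. n \<ge> n0 \<Longrightarrow> \<bar>\<rho> n\<bar> < e / 2"
      using \<rho>(1) by (metis LIMSEQ_iff diff_zero half_gt_zero real_norm_def)
    have "dist (?u i) (?u j) < e" if "n0 \<le> i" "n0 \<le> j" for i j
      using that le[of n0 "i - n0"] le[of n0 "j - n0"] n0[of n0] by (simp add: dist_real_def)
    then show "\<exists>n0. \<forall>i\<ge>n0. \<forall>j\<ge>n0. dist (?u i) (?u j) < e" by blast
  qed
  then show ?thesis
    unfolding invariant_density_def using Cauchy_convergent convergent_LIMSEQ_iff by blast
qed

text \<open>Sign, monotonicity and height survive pointwise limits. The mass 1 survives by dominated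
  convergence, with the constant \<open>4 * kappa\<close> on [0, 1) as dominating function.\<close>

lemma invariant_density_dec_density: "dec_density (4 * kappa) (invariant_density m)"
proof -
  let ?u = "\<lambda>n. transfer_comp \<beta> (m - int n) n (indicator {0..<1})"
  note lim = invariant_density_tendsto[of m]
  have u: "dec_density (4 * kappa) (?u n)" for n
    by (rule transfer_comp_dec_density'[OF order_refl dec_density_indicator])
  have out: "invariant_density m x = 0" if "x \<notin> {0..<1}" for x
    using LIMSEQ_unique[OF lim[of x]] dec_densityD(3)[OF u that] by simp
  have meas: "invariant_density m \<in> borel_measurable lborel"
    by (rule borel_measurable_LIMSEQ_real[OF lim]) (use dec_density_measurable[OF u] in simp)
  have int: "integrable lborel (\<lambda>x. 4 * kappa * indicator {0..<1::real} x)"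
    by simp
  have bound: "AE x in lborel. norm (?u n x) \<le> 4 * kappa * indicator {0..<1} x" for n
  proof (rule AE_I2)
    fix x
    show "norm (?u n x) \<le> 4 * kappa * indicator {0..<1} x"
      using dec_densityD(1,3,6)[OF u[of n], of x] by (auto simp: indicator_def)
  qed
  have ae: "AE x in lborel. (\<lambda>n. ?u n x) \<longlonglongrightarrow> invariant_density m x"
    using lim by simp
  have um: "?u n \<in> borel_measurable lborel" for n
    using dec_density_measurable[OF u] by simp
  have "integrable lborel (invariant_density m)"
    by (rule integrable_dominated_convergence[OF meas um int ae bound])
  moreover have "(\<lambda>n. integral\<^sup>L lborel (?u n)) \<longlonglongrightarrow> integral\<^sup>L lborel (invariant_density m)"
    by (rule integral_dominated_convergence[OF meas um int ae bound])
  moreover have "integral\<^sup>L lborel (?u n) = 1" for n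
    using dec_densityD(4)[OF u[of n]] by (simp add: has_bochner_integral_iff)
  ultimately have "has_bochner_integral lborel (invariant_density m) 1"
    by (simp add: has_bochner_integral_iff LIMSEQ_const_iff)
  moreover have "0 \<le> invariant_density m x" for x
    by (rule LIMSEQ_le_const[OF lim]) (use dec_densityD(1)[OF u] in auto)
  moreover have "invariant_density m y \<le> invariant_density m x" if "0 \<le> x" "x \<le> y" for x y
    by (rule LIMSEQ_le[OF lim lim]) (use dec_densityD(2)[OF u that] in auto)
  moreover have "invariant_density m 0 \<le> 4 * kappa"
    by (rule LIMSEQ_le_const2[OF lim]) (use dec_densityD(5)[OF u] in auto)
  ultimately show ?thesis
    using out by (auto simp: dec_density_def)
qed

text \<open>\<open>transfer\<close> is a finite sum of values and hence commutes with pointwise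
  limits.\<close>

lemma transfer_invariant_density:
  "transfer (base_at \<beta> m) (invariant_density m) = invariant_density (m + 1)"
proof
  fix y
  let ?u = "\<lambda>n. transfer_comp \<beta> (m - int n) n (indicator {0..<1})"
  let ?b = "base_at \<beta> m"
  have "(\<lambda>n. transfer ?b (?u n) y) \<longlonglongrightarrow> transfer ?b (invariant_density m) y"
    using base_at_bounds(4)[of m]
    by (auto simp: transfer_def intro!: tendsto_intros invariant_density_tendsto)
  \<comment> \<open>One more transfer turns approximant \<open>n\<close> for \<open>m\<close> into
    approximant \<open>Suc n\<close> for \<open>m + 1\<close>: both start at time
    \<open>m - n\<close>.\<close>
  moreover have "(\<lambda>n. transfer ?b (?u n) y) \<longlonglongrightarrow> invariant_density (m + 1) y"
    using LIMSEQ_Suc[OF invariant_density_tendsto[of "m + 1" y]] by simp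
  ultimately show "transfer ?b (invariant_density m) y = invariant_density (m + 1) y"
    by (rule LIMSEQ_unique)
qed

lemma transfer_comp_invariant_density:
  "transfer_comp \<beta> m n (invariant_density m) = invariant_density (m + int n)"
  by (induction n) (simp_all add: transfer_invariant_density ac_simps)

end

section \<open>Asymptotic independence in finite measure spaces\<close>

text \<open>A Dynkin argument: \<open>total\<close> handles complements, and for a disjoint union
  Tannery's theorem exchanges the limit in \<open>n\<close> with the sum over the pieces, dominated
  by the summable \<open>measure M (E k)\<close>.\<close>

lemma (in finite_measure) asymptotic_independence_induct:
  assumes G: "Int_stable G" "G \<subseteq> Pow (space M)" "sets M = sigma_sets (space M) G"
    and B: "\<And>n. B n \<in> sets M"
    and total: "(\<lambda>n. measure M (B n)) \<longlonglongrightarrow> measure M (space M) * c"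
    and basic: "\<And>E. E \<in> G \<Longrightarrow> (\<lambda>n. measure M (E \<inter> B n)) \<longlonglongrightarrow> measure M E * c"
    and E: "E \<in> sets M"
  shows "(\<lambda>n. measure M (E \<inter> B n)) \<longlonglongrightarrow> measure M E * c"
  using G(1,2) E[unfolded G(3)]
proof (induction rule: sigma_sets_induct_disjoint)
  case (compl E)
  have E: "E \<in> sets M" using compl.hyps G(3) by simp
  have "measure M ((space M - E) \<inter> B n) = measure M (B n) - measure M (E \<inter> B n)" for n
  proof -
    have "(space M - E) \<inter> B n = B n - E \<inter> B n"
      using sets.sets_into_space[OF B[of n]] by auto
    then show ?thesis using E B[of n] by (simp add: finite_measure_Diff)
  qed
  moreover have "measure M (space M - E) * c = measure M (space M) * c - measure M E * c"
    using E by (simp add: finite_measure_compl left_diff_distrib)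
  ultimately show ?case using tendsto_diff[OF total compl.IH] by simp
next
  case (union E)
  have E: "E k \<in> sets M" for k using union.hyps(2) G(3) by auto
  have disj: "disjoint_family (\<lambda>k. E k \<inter> B n)" for n
    using union.hyps(1) by (auto simp: disjoint_family_on_def)
  have sums: "(\<lambda>k. measure M (E k)) sums measure M (\<Union>k. E k)"
    using E union.hyps(1) by (intro finite_measure_UNION) auto
  have sumsB: "(\<lambda>k. measure M (E k \<inter> B n)) sums measure M ((\<Union>k. E k) \<inter> B n)" for n
    using finite_measure_UNION[of "\<lambda>k. E k \<inter> B n"] E B disj by (auto simp: image_subset_iff)
  have "(\<lambda>n. suminf (\<lambda>k. measure M (E k \<inter> B n))) \<longlonglongrightarrow> suminf (\<lambda>k. measure M (E k) * c)"
  proof (intro conjunct2[OF conjunct2[OF tannerys_theorem]] union.IH always_eventually)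
    show "\<forall>x. case x of (k, n) \<Rightarrow> norm (measure M (E k \<inter> B n)) \<le> measure M (E k)"
      using E B by (auto intro!: finite_measure_mono)
    show "summable (\<lambda>k. measure M (E k))" using sums by (rule sums_summable)
  qed simp
  then show ?case
    using sumsB sums_mult2[OF sums, of c] by (simp add: sums_iff)
qed (use basic in simp_all)

text \<open>Convergence is given for sets only, so \<open>\<phi>\<close> is approximated from below
  by simple functions \<open>g\<close>. The integral of \<open>g\<close> over \<open>B n\<close>
  tends to that of \<open>g\<close> times \<open>c\<close> while staying below \<open>K\<close>;
  then the supremum over \<open>g\<close> is taken.\<close>

lemma (in finite_measure) asymptotic_independence_nn_integral:
  assumes B: "\<And>n. B n \<in> sets M" and c: "0 \<le> c"
    and indep: "\<And>E. E \<in> sets M \<Longrightarrow> (\<lambda>n. measure M (E \<inter> B n)) \<longlonglongrightarrow> measure M E * c"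
    and bound: "\<And>n. (\<integral>\<^sup>+x. \<phi> x * indicator (B n) x \<partial>M) \<le> K"
  shows "(\<integral>\<^sup>+x. \<phi> x \<partial>M) * ennreal c \<le> K"
proof -
  have "integral\<^sup>S M g * ennreal c \<le> K"
    if g: "simple_function M g" "g \<le> \<phi>" "\<forall>x. g x < top" for g
  proof -
    let ?E = "\<lambda>v. g -` {v} \<inter> space M"
    have E: "?E v \<in> sets M" for v using g(1) by (rule simple_functionD(2))
    have fin: "finite (g ` space M)" using g(1) by (rule simple_functionD(1))
    have int: "(\<integral>\<^sup>+x. g x * indicator (B n) x \<partial>M) = (\<Sum>v\<in>g ` space M. v * emeasure M (?E v \<inter> B n))" for n
    proof -
      have "(\<integral>\<^sup>+x. g x * indicator (B n) x \<partial>M)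
          = (\<integral>\<^sup>+x. (\<Sum>v\<in>g ` space M. v * indicator (?E v \<inter> B n) x) \<partial>M)"
        by (intro nn_integral_cong, subst simple_function_indicator_representation[OF g(1)])
          (auto simp: sum_distrib_right sum_distrib_left indicator_inter_arith ac_simps)
      also have "\<dots> = (\<Sum>v\<in>g ` space M. v * emeasure M (?E v \<inter> B n))"
        using E B by (subst nn_integral_sum) (auto intro!: sum.cong nn_integral_cmult_indicator)
      finally show ?thesis .
    qed
    have "(\<lambda>n. emeasure M (?E v \<inter> B n)) \<longlonglongrightarrow> emeasure M (?E v) * ennreal c" for v
      using tendsto_ennrealI[OF indep[OF E[of v]]] c by (simp add: emeasure_eq_measure ennreal_mult)
    then have "(\<lambda>n. \<integral>\<^sup>+x. g x * indicator (B n) x \<partial>M)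
        \<longlonglongrightarrow> (\<Sum>v\<in>g ` space M. v * (emeasure M (?E v) * ennreal c))"
      unfolding int using g(3) by (intro tendsto_sum ennreal_tendsto_cmult) auto
    also have "(\<Sum>v\<in>g ` space M. v * (emeasure M (?E v) * ennreal c)) = integral\<^sup>S M g * ennreal c"
      by (simp add: simple_integral_def sum_distrib_right mult.assoc)
    finally show ?thesis
    proof (rule LIMSEQ_le_const2, intro exI allI impI)
      fix n
      have "(\<integral>\<^sup>+x. g x * indicator (B n) x \<partial>M) \<le> (\<integral>\<^sup>+x. \<phi> x * indicator (B n) x \<partial>M)"
        using g(2) by (intro nn_integral_mono mult_right_mono) (auto simp: le_fun_def)
      then show "(\<integral>\<^sup>+x. g x * indicator (B n) x \<partial>M) \<le> K" using bound[of n] by simp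
    qed
  qed
  then show ?thesis
    \<comment> \<open>\<open>nn_integral_def_finite\<close> takes the supremum over finite-valued
      simple functions, which is why \<open>g x < top\<close> could be assumed above; finiteness of
      \<open>v\<close> lets it be multiplied into a limit in \<open>ennreal\<close>.\<close>
    unfolding nn_integral_def_finite SUP_mult_right_ennreal by (auto intro!: SUP_least)
qed

section \<open>Densities with respect to Lebesgue measure on [0, 1)\<close>

abbreviation unit_lborel :: "real measure" where
  "unit_lborel \<equiv> restrict_space lborel {0..<1}"

lemma space_unit_borel [simp]: "space unit_borel = {0..<1}"
  by (simp add: unit_borel_def space_restrict_space)

lemma sets_unit_lborel [measurable_cong]: "sets unit_lborel = sets unit_borel"
  by (simp add: unit_borel_def sets_restrict_space)

lemma sets_unit_borelD: "A \<in> sets unit_borel \<Longrightarrow> A \<in> sets borel \<and> A \<subseteq> {0..<1}"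
  by (auto simp: unit_borel_def sets_restrict_space)

lemma measurable_unit_lborel:
  "f \<in> borel_measurable borel \<Longrightarrow> f \<in> borel_measurable unit_lborel"
  by (intro measurable_restrict_space1) simp

lemma finite_measure_unit_lborel: "finite_measure unit_lborel"
  by (intro finite_measureI) (simp add: space_restrict_space emeasure_restrict_space)

lemma nn_integral_unit_lborel:
  "(\<And>x. x \<notin> {0..<1} \<Longrightarrow> f x = 0) \<Longrightarrow> (\<integral>\<^sup>+x. f x \<partial>unit_lborel) = (\<integral>\<^sup>+x. f x \<partial>lborel)"
  by (subst nn_integral_restrict_space) (auto intro!: nn_integral_cong simp: indicator_def)

lemma emeasure_density_unit_lborel:
  assumes [measurable]: "h \<in> borel_measurable borel" and A: "A \<in> sets unit_borel"
  shows "emeasure (density unit_lborel (\<lambda>x. ennreal (h x))) A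
    = (\<integral>\<^sup>+x. indicator A x * ennreal (h x) \<partial>lborel)"
proof -
  have "emeasure (density unit_lborel (\<lambda>x. ennreal (h x))) A
      = (\<integral>\<^sup>+x. ennreal (h x) * indicator A x \<partial>unit_lborel)"
    using A by (intro emeasure_density measurable_compose[OF _ measurable_ennreal]
        measurable_unit_lborel) (auto simp: sets_unit_lborel)
  also have "\<dots> = (\<integral>\<^sup>+x. ennreal (h x) * indicator A x \<partial>lborel)"
    using sets_unit_borelD[OF A]
    by (intro nn_integral_unit_lborel) (auto simp: indicator_def subset_eq)
  finally show ?thesis by (simp add: mult.commute)
qed

lemma measure_density_unit_lborel:
  assumes h: "dec_density M h" and A: "A \<in> sets unit_borel"
  shows "measure (density unit_lborel (\<lambda>x. ennreal (h x))) A = (\<integral>x. indicator A x * h x \<partial>lborel)"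
proof -
  note [measurable] = dec_density_measurable[OF h]
  have [measurable]: "A \<in> sets borel" using sets_unit_borelD[OF A] by simp
  have "(\<integral>x. indicator A x * h x \<partial>lborel)
      = enn2real (\<integral>\<^sup>+x. ennreal (indicator A x * h x) \<partial>lborel)"
    using dec_densityD(1)[OF h] by (intro integral_eq_nn_integral) auto
  also have "(\<integral>\<^sup>+x. ennreal (indicator A x * h x) \<partial>lborel)
      = (\<integral>\<^sup>+x. indicator A x * ennreal (h x) \<partial>lborel)"
    by (intro nn_integral_cong) (auto simp: indicator_def)
  finally show ?thesis
    using emeasure_density_unit_lborel[of h A] A by (simp add: measure_def)
qed

lemma beta_map_unit: "0 \<le> beta_map b x" "beta_map b x < 1"
  unfolding beta_map_def by linarith+

lemma beta_comp_unit: "x \<in> {0..<1} \<Longrightarrow> beta_comp \<beta> m n x \<in> {0..<1}"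
  by (cases n) (auto simp: beta_map_unit)

lemma beta_comp_measurable_unit [measurable]: "beta_comp \<beta> m n \<in> unit_borel \<rightarrow>\<^sub>M unit_borel"
  unfolding unit_borel_def
  by (intro measurable_restrict_space3) (auto intro: beta_comp_unit simp del: atLeastLessThan_iff)

lemma beta_comp_vimage:
  "A \<in> sets unit_borel \<Longrightarrow> beta_comp \<beta> m n -` A \<inter> {0..<1} \<in> sets unit_borel"
  using measurable_sets[OF beta_comp_measurable_unit, of A \<beta> m n] by simp

section \<open>The absolutely continuous invariant measures\<close>

context alternate_base
begin

text \<open>Duality between composition and transfer. The induction hypothesis is applied to the
  test function composed with the last map, which leaves a single step for
  \<open>nn_integral_transfer\<close>.\<close>

lemma nn_integral_transfer_comp:
  fixes u :: "real \<Rightarrow> ennreal"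
  assumes h: "dec_density M h" and u: "u \<in> borel_measurable borel"
  shows "(\<integral>\<^sup>+x. u (beta_comp \<beta> m n x) * h x \<partial>lborel)
    = (\<integral>\<^sup>+y. u y * transfer_comp \<beta> m n h y \<partial>lborel)"
  using u
proof (induction n arbitrary: u)
  case 0
  then show ?case by simp
next
  case (Suc n)
  note g = transfer_comp_dec_density[OF h, of n m]
  let ?b = "base_at \<beta> (m + int n)"
  have "(\<integral>\<^sup>+x. u (beta_comp \<beta> m (Suc n) x) * h x \<partial>lborel)
      = (\<integral>\<^sup>+x. u (beta_map ?b x) * transfer_comp \<beta> m n h x \<partial>lborel)"
    using Suc.IH[of "\<lambda>x. u (beta_map ?b x)"] Suc.prems by simp
  also have "\<dots> = (\<integral>\<^sup>+y. u y * transfer_comp \<beta> m (Suc n) h y \<partial>lborel)"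
    using nn_integral_transfer[OF base_at_bounds(4) dec_density_measurable[OF g] Suc.prems
        dec_densityD(1,3)[OF g]] by simp
  finally show ?case .
qed

text \<open>The duality for the test function \<open>indicator A\<close>: transferring a density is
  pushing its measure forward.\<close>

lemma distr_density_beta_comp:
  assumes h: "dec_density M h"
  shows "distr (density unit_lborel (\<lambda>x. ennreal (h x))) unit_borel (beta_comp \<beta> m n)
    = density unit_lborel (\<lambda>x. ennreal (transfer_comp \<beta> m n h x))"
proof (rule measure_eqI)
  fix A assume "A \<in> sets (distr (density unit_lborel (\<lambda>x. ennreal (h x))) unit_borel (beta_comp \<beta> m n))"
  then have A: "A \<in> sets unit_borel" by simp
  let ?T = "beta_comp \<beta> m n"
  note [measurable] = dec_density_measurable[OF h]
  have "emeasure (distr (density unit_lborel (\<lambda>x. ennreal (h x))) unit_borel ?T) A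
      = emeasure (density unit_lborel (\<lambda>x. ennreal (h x))) (?T -` A \<inter> {0..<1})"
    using A by (subst emeasure_distr) (auto simp: space_restrict_space)
  also have "\<dots> = (\<integral>\<^sup>+x. indicator (?T -` A \<inter> {0..<1}) x * ennreal (h x) \<partial>lborel)"
    by (rule emeasure_density_unit_lborel[OF _ beta_comp_vimage[OF A]]) measurable
  also have "\<dots> = (\<integral>\<^sup>+x. indicator A (?T x) * ennreal (h x) \<partial>lborel)"
    using dec_densityD(3)[OF h] by (intro nn_integral_cong) (auto simp: indicator_def)
  also have "\<dots> = (\<integral>\<^sup>+y. indicator A y * ennreal (transfer_comp \<beta> m n h y) \<partial>lborel)"
    using sets_unit_borelD[OF A] by (intro nn_integral_transfer_comp[OF h]) auto
  also have "\<dots> = emeasure (density unit_lborel (\<lambda>x. ennreal (transfer_comp \<beta> m n h x))) A"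
    by (rule emeasure_density_unit_lborel[symmetric, OF _ A]) measurable
  finally show "emeasure (distr (density unit_lborel (\<lambda>x. ennreal (h x))) unit_borel ?T) A
      = emeasure (density unit_lborel (\<lambda>x. ennreal (transfer_comp \<beta> m n h x))) A" .
qed (simp add: sets_unit_lborel)

definition invariant_measure :: "int \<Rightarrow> real measure" where
  "invariant_measure m = density unit_lborel (\<lambda>x. ennreal (invariant_density m x))"

lemma sets_invariant_measure [simp, measurable_cong]: "sets (invariant_measure m) = sets unit_borel"
  by (simp add: invariant_measure_def sets_unit_lborel)

lemma space_invariant_measure [simp]: "space (invariant_measure m) = {0..<1}"
  by (simp add: invariant_measure_def space_restrict_space)

lemma emeasure_space_invariant_measure: "emeasure (invariant_measure m) {0..<1} = 1"
proof -
  note h = invariant_density_dec_density[of m]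
  have "{0..<1} \<in> sets unit_borel" by (metis sets.top space_unit_borel)
  then have "emeasure (invariant_measure m) {0..<1}
      = (\<integral>\<^sup>+x. indicator {0..<1} x * ennreal (invariant_density m x) \<partial>lborel)"
    unfolding invariant_measure_def
    by (intro emeasure_density_unit_lborel dec_density_measurable[OF h])
  also have "\<dots> = (\<integral>\<^sup>+x. ennreal (invariant_density m x) \<partial>lborel)"
    using dec_densityD(3)[OF h] by (intro nn_integral_cong) (auto simp: indicator_def)
  finally show ?thesis using dec_density_nn_integral[OF h] by simp
qed

lemma finite_invariant_measure: "finite_measure (invariant_measure m)"
  by (intro finite_measureI) (simp add: emeasure_space_invariant_measure)

text \<open>The family is equivariant: the index moves with the number of maps applied. Invariance
  appears once that number is a multiple of the period.\<close>

lemma distr_invariant_measure: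
  "distr (invariant_measure m) unit_borel (beta_comp \<beta> m n) = invariant_measure (m + int n)"
  unfolding invariant_measure_def
  using distr_density_beta_comp[OF invariant_density_dec_density]
  by (simp add: transfer_comp_invariant_density)

lemma base_at_periodic: "base_at \<beta> (m + int (k * length \<beta>)) = base_at \<beta> m"
  by (simp add: base_at_def)

lemma transfer_comp_periodic:
  "transfer_comp \<beta> (m + int (k * length \<beta>)) n h = transfer_comp \<beta> m n h"
proof (induction n)
  case (Suc n)
  then show ?case
    using base_at_periodic[of "m + int n" k] by (simp add: ac_simps)
qed simp

lemma beta_comp_periodic:
  "beta_comp \<beta> (m + int (k * length \<beta>)) n x = beta_comp \<beta> m n x"
proof (induction n)
  case (Suc n)
  then show ?case
    using base_at_periodic[of "m + int n" k] by (simp add: ac_simps)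
qed simp

lemma invariant_density_periodic:
  "invariant_density (m + int (k * length \<beta>)) = invariant_density m"
  unfolding invariant_density_def fun_eq_iff
  using transfer_comp_periodic[of "m - int _" k] by (simp add: algebra_simps)

lemma invariant_measure_periodic:
  "invariant_measure (m + int (k * length \<beta>)) = invariant_measure m"
  by (simp only: invariant_measure_def invariant_density_periodic)

text \<open>The normalised indicator of [0, c) and the invariant density are both decreasing
  densities, and the latter is fixed by full periods. By \<open>loss_of_memory\<close> the masses
  that their transfers give to \<open>A\<close> differ by at most
  \<open>\<rho> (n * ?p)\<close>.\<close>

lemma beta_comp_asymptotic_independence_interval:
  assumes A: "A \<in> sets unit_borel" and c: "0 < c" "c \<le> 1"
  shows "(\<lambda>n. measure unit_lborel ({0..<c} \<inter> (beta_comp \<beta> m (n * length \<beta>) -` A \<inter> {0..<1})))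
    \<longlonglongrightarrow> c * measure (invariant_measure m) A"
proof -
  let ?g = "\<lambda>x. indicator {0..<c} x / c" and ?h = "invariant_density m"
  let ?p = "length \<beta>"
  let ?B = "\<lambda>n. beta_comp \<beta> m (n * ?p) -` A \<inter> {0..<1}"
  \<comment> \<open>The class has to contain a density of height \<open>1 / c\<close> and to meet
    the threshold of \<open>loss_of_memory\<close>.\<close>
  define M where "M = max (1 / c) (4 * kappa)"
  have g: "dec_density M ?g" and h: "dec_density M ?h"
    using dec_density_uniform[OF c] invariant_density_dec_density[of m]
    by (auto simp: dec_density_def M_def)
  have M: "4 * kappa \<le> M" by (simp add: M_def)
  obtain \<rho> :: "nat \<Rightarrow> real" where \<rho>: "\<rho> \<longlonglongrightarrow> 0"
    "\<And>m n f g y. dec_density M f \<Longrightarrow> dec_density M g \<Longrightarrow>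
       \<bar>transfer_comp \<beta> m n f y - transfer_comp \<beta> m n g y\<bar> \<le> \<rho> n"
    using loss_of_memory[OF M] by blast
  have [measurable]: "A \<in> sets borel" using sets_unit_borelD[OF A] by simp
  have "norm (measure unit_lborel ({0..<c} \<inter> ?B n) / c - measure (invariant_measure m) A) \<le> \<rho> (n * ?p)"
    for n
  proof -
    let ?G = "transfer_comp \<beta> m (n * ?p) ?g" and ?H = "transfer_comp \<beta> m (n * ?p) ?h"
    have G: "dec_density M ?G" and H: "dec_density M ?H"
      by (rule transfer_comp_dec_density'[OF M g], rule transfer_comp_dec_density'[OF M h])
    have B: "?B n \<in> sets unit_borel" by (rule beta_comp_vimage[OF A])
    have "measure (density unit_lborel (\<lambda>x. ennreal (?g x))) (?B n)
        = measure (density unit_lborel (\<lambda>x. ennreal (?G x))) A"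
      unfolding distr_density_beta_comp[OF g, symmetric]
      using A by (subst measure_distr) (auto simp: space_restrict_space)
    moreover have "measure (density unit_lborel (\<lambda>x. ennreal (?g x))) (?B n)
        = measure unit_lborel ({0..<c} \<inter> ?B n) / c"
    proof -
      have "measure (density unit_lborel (\<lambda>x. ennreal (?g x))) (?B n)
          = (\<integral>x. indicator ({0..<c} \<inter> ?B n) x / c \<partial>lborel)"
        unfolding measure_density_unit_lborel[OF g B]
        by (intro Bochner_Integration.integral_cong) (auto simp: indicator_def)
      also have "\<dots> = measure lborel ({0..<c} \<inter> ?B n) / c" by simp
      also have "measure lborel ({0..<c} \<inter> ?B n) = measure unit_lborel ({0..<c} \<inter> ?B n)"
        by (subst measure_restrict_space) auto
      finally show ?thesis .
    qed
    moreover have "?H = ?h"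
      using transfer_comp_invariant_density invariant_density_periodic by simp
    ultimately have eq: "measure unit_lborel ({0..<c} \<inter> ?B n) / c - measure (invariant_measure m) A
        = (\<integral>x. indicator A x * ?G x \<partial>lborel) - (\<integral>x. indicator A x * ?H x \<partial>lborel)"
      unfolding invariant_measure_def
      using measure_density_unit_lborel[OF G A] measure_density_unit_lborel[OF H A] by simp
    have int: "integrable lborel (\<lambda>x. indicator A x * f x)" if "dec_density M f" for f :: "real \<Rightarrow> real"
      using dec_densityD(4)[OF that] integrable_real_mult_indicator[of A lborel f]
      by (simp add: has_bochner_integral_iff mult.commute)
    have "norm ((\<integral>x. indicator A x * ?G x \<partial>lborel) - (\<integral>x. indicator A x * ?H x \<partial>lborel))
        = norm (\<integral>x. indicator A x * ?G x - indicator A x * ?H x \<partial>lborel)"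
      using int[OF G] int[OF H] by simp
    also have "\<dots> \<le> (\<integral>x. norm (indicator A x * ?G x - indicator A x * ?H x) \<partial>lborel)"
      by (rule integral_norm_bound)
    also have "\<dots> \<le> (\<integral>x. \<rho> (n * ?p) * indicator {0..<1::real} x \<partial>lborel)"
    proof (rule integral_mono)
      show "integrable lborel (\<lambda>x. norm (indicator A x * ?G x - indicator A x * ?H x))"
        by (intro integrable_norm Bochner_Integration.integrable_diff int G H)
      fix x
      show "norm (indicator A x * ?G x - indicator A x * ?H x) \<le> \<rho> (n * ?p) * indicator {0..<1} x"
        using \<rho>(2)[OF g h, of m "n * ?p" x] sets_unit_borelD[OF A] by (auto simp: indicator_def)
    qed simp
    also have "\<dots> = \<rho> (n * ?p)" by simp
    finally show ?thesis unfolding eq .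
  qed
  moreover have "(\<lambda>n. \<rho> (n * ?p)) \<longlonglongrightarrow> 0"
  proof (rule filterlim_compose[OF \<rho>(1)])
    show "filterlim (\<lambda>n. n * ?p) at_top sequentially"
      using nonempty by (intro filterlim_subseq strict_monoI) auto
  qed
  ultimately have "(\<lambda>n. measure unit_lborel ({0..<c} \<inter> ?B n) / c - measure (invariant_measure m) A) \<longlonglongrightarrow> 0"
    by (rule Lim_null_comparison[OF always_eventually[OF allI]])
  then have "(\<lambda>n. c * (measure unit_lborel ({0..<c} \<inter> ?B n) / c)) \<longlonglongrightarrow> c * measure (invariant_measure m) A"
    by (intro tendsto_mult_left) (simp add: LIM_zero_iff)
  then show ?thesis using c by simp
qed

text \<open>Extends the interval case by the Dynkin argument, the intervals starting at 0 being an
  intersection-stable generator.\<close>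

lemma beta_comp_asymptotic_independence:
  assumes A: "A \<in> sets unit_borel" and E: "E \<in> sets unit_borel"
  shows "(\<lambda>n. measure unit_lborel (E \<inter> (beta_comp \<beta> m (n * length \<beta>) -` A \<inter> {0..<1})))
    \<longlonglongrightarrow> measure unit_lborel E * measure (invariant_measure m) A"
proof -
  interpret finite_measure unit_lborel by (rule finite_measure_unit_lborel)
  \<comment> \<open>Traces on [0, 1) of the half-lines that generate the Borel sets, so that
    \<open>sigma_sets_Int\<close> applies. They include the empty set and all of [0, 1), whence the
    case \<open>x \<le> 0\<close> and the endpoint \<open>min x 1\<close> below.\<close>
  let ?G = "(\<inter>) {0..<1::real} ` range lessThan"
  let ?B = "\<lambda>n. beta_comp \<beta> m (n * length \<beta>) -` A \<inter> {0..<1}"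
  have space: "space unit_lborel = {0..<1}" by (simp add: space_restrict_space)
  show ?thesis
  proof (rule asymptotic_independence_induct[where G = ?G])
    show "Int_stable ?G"
    proof (rule Int_stableI)
      fix a b assume "a \<in> ?G" "b \<in> ?G"
      then obtain x y where "a = {0..<1} \<inter> {..<x}" "b = {0..<1} \<inter> {..<y}" by auto
      then have "a \<inter> b = {0..<1} \<inter> {..<min x y}" by auto
      then show "a \<inter> b \<in> ?G" by blast
    qed
    show "?G \<subseteq> Pow (space unit_lborel)" unfolding space by auto
    have borel: "sets borel = sigma_sets UNIV (range lessThan :: real set set)"
      unfolding borel_Iio by simp
    show "sets unit_lborel = sigma_sets (space unit_lborel) ?G"
    proof -
      have "{0..<1::real} \<in> sigma_sets UNIV (range lessThan)"
        unfolding borel[symmetric] by simp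
      then show ?thesis
        unfolding space using sigma_sets_Int[of "{0..<1}" UNIV "range lessThan"]
        by (simp add: sets_restrict_space borel)
    qed
    show "?B n \<in> sets unit_lborel" for n
      using beta_comp_vimage[OF A] by (simp add: sets_unit_lborel)
    show "E \<in> sets unit_lborel" using E by (simp add: sets_unit_lborel)
    have m1: "measure unit_lborel {0..<c} = c" if "0 < c" "c \<le> 1" for c
      using that by (subst measure_restrict_space) auto
    show "(\<lambda>n. measure unit_lborel (?B n))
        \<longlonglongrightarrow> measure unit_lborel (space unit_lborel) * measure (invariant_measure m) A"
      using beta_comp_asymptotic_independence_interval[OF A, of 1 m] m1[of 1]
      by (simp add: space Int_absorb1)
    fix F assume "F \<in> ?G"
    then obtain x where x: "F = {0..<1} \<inter> {..<x}" by auto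
    show "(\<lambda>n. measure unit_lborel (F \<inter> ?B n))
        \<longlonglongrightarrow> measure unit_lborel F * measure (invariant_measure m) A"
    proof (cases "x \<le> 0")
      case True
      then have "F = {}" using x by auto
      then show ?thesis by simp
    next
      case False
      then have "F = {0..<min x 1}" using x by auto
      then show ?thesis
        using beta_comp_asymptotic_independence_interval[OF A, of "min x 1" m] m1[of "min x 1"] False
        by simp
    qed
  qed
qed

lemma ac_invariant_invariant_measure:
  "ac_invariant (beta_comp \<beta> m (length \<beta>)) (invariant_measure m)"
  unfolding ac_invariant_def dynamical_system_def
proof (intro conjI)
  show "absolutely_continuous unit_lborel (invariant_measure m)"
    unfolding invariant_measure_def
    by (intro absolutely_continuousI_density measurable_compose[OF _ measurable_ennreal]
        measurable_unit_lborel dec_density_measurable[OF invariant_density_dec_density])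
  show "distr (invariant_measure m) (invariant_measure m) (beta_comp \<beta> m (length \<beta>))
      = invariant_measure m"
    using distr_invariant_measure[of m "length \<beta>"] invariant_measure_periodic[of m 1]
    by (simp cong: distr_cong)
qed (simp_all add: emeasure_space_invariant_measure)

text \<open>With \<open>\<phi>\<close> the density of \<open>\<nu>\<close>, invariance makes the
  integral of \<open>\<phi>\<close> over the preimage of \<open>A\<close> under \<open>n\<close>
  periods equal to \<open>emeasure \<nu> A\<close>. Asymptotic independence bounds these integrals
  from below in the limit, so \<open>\<nu>\<close> dominates
  \<open>invariant_measure m\<close>.\<close>

lemma ac_invariant_unique:
  assumes "ac_invariant (beta_comp \<beta> m (length \<beta>)) \<nu>"
  shows "\<nu> = invariant_measure m"
proof -
  let ?T = "beta_comp \<beta> m (length \<beta>)" and ?\<mu> = "invariant_measure m"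
  have sets: "sets \<nu> = sets unit_borel" and ac: "absolutely_continuous unit_lborel \<nu>"
    and ds: "dynamical_system \<nu> ?T"
    using assms by (auto simp: ac_invariant_def)
  have space: "space \<nu> = {0..<1}" using sets_eq_imp_space_eq[OF sets] by simp
  have one: "emeasure \<nu> {0..<1} = 1" and inv: "distr \<nu> \<nu> ?T = \<nu>"
    using ds space by (auto simp: dynamical_system_def)
  interpret \<nu>: finite_measure \<nu> using one space by (intro finite_measureI) simp
  interpret \<mu>: finite_measure ?\<mu> by (rule finite_invariant_measure)
  interpret L: finite_measure unit_lborel by (rule finite_measure_unit_lborel)
  obtain \<phi> where \<phi>[measurable]: "\<phi> \<in> borel_measurable unit_lborel" and dens: "density unit_lborel \<phi> = \<nu>"
    using L.Radon_Nikodym[OF ac] sets by (auto simp: sets_unit_lborel)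
  have iter: "emeasure \<nu> (beta_comp \<beta> m (n * length \<beta>) -` A \<inter> {0..<1}) = emeasure \<nu> A"
    if A: "A \<in> sets unit_borel" for n A
  proof (induction n)
    case 0
    then show ?case using sets_unit_borelD[OF A] by (simp add: Int_absorb2)
  next
    case (Suc n)
    let ?B = "beta_comp \<beta> m (n * length \<beta>) -` A \<inter> {0..<1}"
    have B: "?B \<in> sets unit_borel" by (rule beta_comp_vimage[OF A])
    \<comment> \<open>The first period is split off; the others start at
      \<open>m + int (length \<beta>)\<close>, which periodicity identifies with
      \<open>m\<close>.\<close>
    have "beta_comp \<beta> m (Suc n * length \<beta>) x = beta_comp \<beta> m (n * length \<beta>) (?T x)" for x
      using beta_comp_periodic[of m 1] by (simp add: beta_comp_add)
    then have "beta_comp \<beta> m (Suc n * length \<beta>) -` A \<inter> {0..<1} = ?T -` ?B \<inter> {0..<1}"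
      using beta_comp_unit[of _ \<beta> m "length \<beta>"] by auto
    also have "emeasure \<nu> \<dots> = emeasure (distr \<nu> \<nu> ?T) ?B"
      using B sets space by (subst emeasure_distr) (auto simp: measurable_cong_sets[OF sets sets])
    finally show ?case using Suc inv by simp
  qed
  have ge: "emeasure ?\<mu> A \<le> emeasure \<nu> A" if A: "A \<in> sets unit_borel" for A
  proof -
    let ?B = "\<lambda>n. beta_comp \<beta> m (n * length \<beta>) -` A \<inter> {0..<1}"
    have B: "?B n \<in> sets unit_lborel" for n
      using beta_comp_vimage[OF A] by (simp add: sets_unit_lborel)
    have "(\<integral>\<^sup>+x. \<phi> x \<partial>unit_lborel) * ennreal (measure ?\<mu> A) \<le> emeasure \<nu> A"
    proof (rule L.asymptotic_independence_nn_integral[OF B])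
      show "(\<integral>\<^sup>+x. \<phi> x * indicator (?B n) x \<partial>unit_lborel) \<le> emeasure \<nu> A" for n
        using iter[OF A, of n] emeasure_density[OF \<phi> B[of n]] by (simp add: dens)
    qed (use beta_comp_asymptotic_independence[OF A] in \<open>auto simp: sets_unit_lborel\<close>)
    moreover have "(\<integral>\<^sup>+x. \<phi> x \<partial>unit_lborel) = 1"
    proof -
      have "(\<integral>\<^sup>+x. \<phi> x \<partial>unit_lborel) = (\<integral>\<^sup>+x. \<phi> x * indicator {0..<1} x \<partial>unit_lborel)"
        by (intro nn_integral_cong) (auto simp: space_restrict_space)
      also have "\<dots> = emeasure \<nu> {0..<1}"
        unfolding dens[symmetric] by (rule emeasure_density[symmetric]) (auto simp: sets_restrict_space)
      finally show ?thesis using one by simp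
    qed
    ultimately show ?thesis by (simp add: \<mu>.emeasure_eq_measure)
  qed
  show ?thesis
  proof (rule measure_eqI)
    show "sets \<nu> = sets ?\<mu>" using sets by simp
    fix A assume "A \<in> sets \<nu>"
    then have A: "A \<in> sets unit_borel" using sets by simp
    \<comment> \<open>Both total masses are 1, so the inequality for \<open>A\<close> and for its
      complement forces equality.\<close>
    have "measure ?\<mu> A \<le> measure \<nu> A" "measure ?\<mu> ({0..<1} - A) \<le> measure \<nu> ({0..<1} - A)"
      using ge[OF A] ge[of "{0..<1} - A"] sets.compl_sets[OF A]
      by (auto simp: \<mu>.emeasure_eq_measure \<nu>.emeasure_eq_measure)
    moreover have "measure ?\<mu> ({0..<1} - A) = 1 - measure ?\<mu> A"
      using \<mu>.finite_measure_compl[of A] A emeasure_space_invariant_measure[of m]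
      by (simp add: measure_def)
    moreover have "measure \<nu> ({0..<1} - A) = 1 - measure \<nu> A"
      using \<nu>.finite_measure_compl[of A] A sets space one by (simp add: measure_def)
    ultimately show "emeasure \<nu> A = emeasure ?\<mu> A"
      by (simp add: \<mu>.emeasure_eq_measure \<nu>.emeasure_eq_measure)
  qed
qed

text \<open>Existence and uniqueness at the index \<open>i - length \<beta>\<close> of the
  definition resolve the definite description; periodicity then moves the index to
  \<open>i\<close>.\<close>

lemma component_measure_eq: "component_measure \<beta> i = invariant_measure (int i)"
proof -
  let ?m = "int i - int (length \<beta>)"
  have "component_measure \<beta> i = invariant_measure ?m"
    unfolding component_measure_def
    by (rule the_equality) (rule ac_invariant_invariant_measure, rule ac_invariant_unique)
  then show ?thesis using invariant_measure_periodic[of ?m 1] by simp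
qed

end

section \<open>The skew product and the shift\<close>

text \<open>Reduces membership to the sections over each \<open>i\<close>, so that later
  measurability proofs take place in \<open>unit_borel\<close>.\<close>

lemma alt_algebra_iff:
  "E \<in> alt_algebra p \<longleftrightarrow>
     E \<subseteq> {..<p} \<times> UNIV \<and> (\<forall>i<p. {x. (i, x) \<in> E} \<in> sets unit_borel)"
proof
  assume "E \<in> alt_algebra p"
  then obtain B where B: "E = (\<Union>i<p. {i} \<times> B i)" "\<forall>i<p. B i \<in> sets unit_borel"
    by (auto simp: alt_algebra_def)
  have sec: "{x. (i, x) \<in> E} = B i" if "i < p" for i
    unfolding B(1) using that by blast
  show "E \<subseteq> {..<p} \<times> UNIV \<and> (\<forall>i<p. {x. (i, x) \<in> E} \<in> sets unit_borel)"
  proof (intro conjI allI impI)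
    show "E \<subseteq> {..<p} \<times> UNIV" unfolding B(1) by blast
  qed (use B(2) sec in simp)
next
  assume E: "E \<subseteq> {..<p} \<times> UNIV \<and> (\<forall>i<p. {x. (i, x) \<in> E} \<in> sets unit_borel)"
  then have "E = (\<Union>i<p. {i} \<times> {x. (i, x) \<in> E})" by fast
  with E show "E \<in> alt_algebra p"
    unfolding alt_algebra_def by (intro CollectI exI[of _ "\<lambda>i. {x. (i, x) \<in> E}"] conjI) simp_all
qed

lemma sigma_algebra_alt_algebra: "sigma_algebra ({..<p} \<times> {0..<1}) (alt_algebra p)"
  unfolding sigma_algebra_iff2
proof (intro conjI ballI allI impI)
  show "alt_algebra p \<subseteq> Pow ({..<p} \<times> {0..<1})"
    using sets_unit_borelD unfolding alt_algebra_def by blast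
  show "{} \<in> alt_algebra p" by (simp add: alt_algebra_iff)
next
  fix E assume E: "E \<in> alt_algebra p"
  show "{..<p} \<times> {0..<1} - E \<in> alt_algebra p"
    unfolding alt_algebra_iff
  proof (intro conjI allI impI)
    fix i assume "i < p"
    then have "space unit_borel - {x. (i, x) \<in> E} \<in> sets unit_borel"
      using E by (intro sets.compl_sets) (simp add: alt_algebra_iff)
    also have "space unit_borel - {x. (i, x) \<in> E} = {x. (i, x) \<in> {..<p} \<times> {0..<1} - E}"
      using \<open>i < p\<close> by auto
    finally show "{x. (i, x) \<in> {..<p} \<times> {0..<1} - E} \<in> sets unit_borel" .
  qed blast
next
  fix A :: "nat \<Rightarrow> (nat \<times> real) set" assume A: "range A \<subseteq> alt_algebra p"
  have A: "A n \<in> alt_algebra p" for n using A by blast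
  show "(\<Union>n. A n) \<in> alt_algebra p"
    unfolding alt_algebra_iff
  proof (intro conjI allI impI)
    show "(\<Union>n. A n) \<subseteq> {..<p} \<times> UNIV" using A unfolding alt_algebra_iff by blast
    fix i assume "i < p"
    then have "(\<Union>n. {x. (i, x) \<in> A n}) \<in> sets unit_borel"
      using A by (intro sets.countable_UN) (auto simp: alt_algebra_iff)
    also have "(\<Union>n. {x. (i, x) \<in> A n}) = {x. (i, x) \<in> (\<Union>n. A n)}" by blast
    finally show "{x. (i, x) \<in> (\<Union>n. A n)} \<in> sets unit_borel" .
  qed
qed

lemma length_base_shift [simp]: "length (base_shift \<beta> m) = length \<beta>"
  by (simp add: base_shift_def)

lemma set_cylinder_subset: "cylinder A ` lists A \<subseteq> Pow (UNIV \<rightarrow> A)"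
  by (auto simp: cylinder_def)

lemma alt_shift_algebra_subset: "alt_shift_algebra \<beta> \<subseteq> Pow (alt_shift_space \<beta>)"
  unfolding alt_shift_algebra_def alt_shift_space_def by blast

text \<open>The preimage of the cylinder of \<open>u\<close> is the union, over the finitely many
  letters \<open>a\<close>, of the cylinders of \<open>a # u\<close>.\<close>

lemma shift_measurable_cylinder_algebra:
  assumes fin: "finite A" and C: "C \<in> cylinder_algebra A"
  shows "{w \<in> UNIV \<rightarrow> A. (\<lambda>n. w (Suc n)) \<in> C} \<in> cylinder_algebra A"
proof -
  let ?S = "sigma (UNIV \<rightarrow> A) (cylinder A ` lists A)"
  have sets: "sets ?S = cylinder_algebra A"
    using set_cylinder_subset by (simp add: cylinder_algebra_def)
  have "(\<lambda>w n. w (Suc n)) \<in> ?S \<rightarrow>\<^sub>M ?S"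
  proof (rule measurable_measure_of[OF set_cylinder_subset])
    fix D assume "D \<in> cylinder A ` lists A"
    then obtain u where u: "u \<in> lists A" "D = cylinder A u" by auto
    have "(\<lambda>w n. w (Suc n)) -` D \<inter> space ?S = (\<Union>a\<in>A. cylinder A (a # u))"
    proof (intro equalityI subsetI)
      fix w assume "w \<in> (\<lambda>w n. w (Suc n)) -` D \<inter> space ?S"
      then have "w \<in> UNIV \<rightarrow> A" "\<forall>k<length u. w (Suc k) = u ! k"
        by (auto simp: u cylinder_def space_measure_of_conv)
      then have "w \<in> cylinder A (w 0 # u)" "w 0 \<in> A"
        by (auto simp: cylinder_def nth_Cons split: nat.split)
      then show "w \<in> (\<Union>a\<in>A. cylinder A (a # u))" by blast
    next
      fix w assume "w \<in> (\<Union>a\<in>A. cylinder A (a # u))"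
      then obtain a where "w \<in> cylinder A (a # u)" by blast
      then have w: "w \<in> UNIV \<rightarrow> A" "\<And>k. k < Suc (length u) \<Longrightarrow> w k = (a # u) ! k"
        by (auto simp: cylinder_def)
      then show "w \<in> (\<lambda>w n. w (Suc n)) -` D \<inter> space ?S"
        using w(2)[of "Suc _"] by (auto simp: u cylinder_def space_measure_of_conv)
    qed
    moreover have "cylinder A (a # u) \<in> sets ?S" if "a \<in> A" for a
      unfolding sets cylinder_algebra_def using that u(1) by (intro sigma_sets.Basic) auto
    ultimately show "(\<lambda>w n. w (Suc n)) -` D \<inter> space ?S \<in> sets ?S"
      using fin by auto
  qed (auto simp: space_measure_of_conv)
  from measurable_sets[OF this, of C] C
  have "(\<lambda>w n. w (Suc n)) -` C \<inter> (UNIV \<rightarrow> A) \<in> cylinder_algebra A"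
    by (simp add: sets[symmetric] space_measure_of_conv)
  moreover have "(\<lambda>w n. w (Suc n)) -` C \<inter> (UNIV \<rightarrow> A) = {w \<in> UNIV \<rightarrow> A. (\<lambda>n. w (Suc n)) \<in> C}"
    by auto
  ultimately show ?thesis by simp
qed

context alternate_base
begin

lemma length_pos: "0 < length \<beta>"
  using nonempty by simp

lemma space_alt_measure [simp]: "space (alt_measure \<beta>) = {..<length \<beta>} \<times> {0..<1}"
  by (simp add: alt_measure_def space_measure_of_conv)

lemma sets_alt_measure: "sets (alt_measure \<beta>) = alt_algebra (length \<beta>)"
  unfolding alt_measure_def
  by (rule sigma_algebra.sets_measure_of_eq[OF sigma_algebra_alt_algebra])

text \<open>\<open>measure_of\<close> takes the prescribed values once these are shown positive and
  countably additive, which is checked section by section.\<close>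

lemma emeasure_alt_measure:
  assumes "E \<in> alt_algebra (length \<beta>)"
  shows "emeasure (alt_measure \<beta>) E =
    (\<Sum>i<length \<beta>. emeasure (invariant_measure (int i)) {x. (i, x) \<in> E}) / of_nat (length \<beta>)"
    (is "_ = ?\<mu> E")
proof -
  let ?p = "length \<beta>"
  have "countably_additive (alt_algebra ?p) ?\<mu>"
    unfolding countably_additive_def
  proof (intro allI impI)
    fix A :: "nat \<Rightarrow> (nat \<times> real) set"
    assume A: "range A \<subseteq> alt_algebra ?p" and disj: "disjoint_family A"
    have sec: "(\<Sum>n. emeasure (invariant_measure (int i)) {x. (i, x) \<in> A n})
        = emeasure (invariant_measure (int i)) {x. (i, x) \<in> (\<Union>n. A n)}" if "i < ?p" for i
    proof -
      have "{x. (i, x) \<in> A n} \<in> sets unit_borel" for n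
      proof -
        have "A n \<in> alt_algebra ?p" using A by blast
        then show ?thesis using that by (simp add: alt_algebra_iff)
      qed
      moreover have "disjoint_family (\<lambda>n. {x. (i, x) \<in> A n})"
        using disj by (auto simp: disjoint_family_on_def)
      ultimately have "(\<Sum>n. emeasure (invariant_measure (int i)) {x. (i, x) \<in> A n})
          = emeasure (invariant_measure (int i)) (\<Union>n. {x. (i, x) \<in> A n})"
        by (intro suminf_emeasure) auto
      also have "(\<Union>n. {x. (i, x) \<in> A n}) = {x. (i, x) \<in> (\<Union>n. A n)}" by blast
      finally show ?thesis .
    qed
    have "(\<Sum>n. ?\<mu> (A n))
        = (\<Sum>n. \<Sum>i<?p. emeasure (invariant_measure (int i)) {x. (i, x) \<in> A n}) / of_nat ?p"
      by (simp add: divide_ennreal_def)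
    also have "(\<Sum>n. \<Sum>i<?p. emeasure (invariant_measure (int i)) {x. (i, x) \<in> A n})
        = (\<Sum>i<?p. \<Sum>n. emeasure (invariant_measure (int i)) {x. (i, x) \<in> A n})"
      by (rule suminf_sum) simp
    finally show "(\<Sum>n. ?\<mu> (A n)) = ?\<mu> (\<Union>n. A n)" using sec by simp
  qed
  moreover have "positive (alt_algebra ?p) ?\<mu>" by (simp add: positive_def)
  ultimately show ?thesis
    unfolding alt_measure_def component_measure_eq
    by (intro emeasure_measure_of_sigma[OF sigma_algebra_alt_algebra _ _ assms])
qed

lemma emeasure_space_alt_measure: "emeasure (alt_measure \<beta>) (space (alt_measure \<beta>)) = 1"
proof -
  have "emeasure (alt_measure \<beta>) (space (alt_measure \<beta>))
      = (\<Sum>i<length \<beta>. emeasure (invariant_measure (int i)) {0..<1}) / of_nat (length \<beta>)"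
  proof -
    have "{x. (i, x) \<in> {..<length \<beta>} \<times> {0..<1::real}} = {0..<1}" if "i < length \<beta>" for i
      using that by auto
    then show ?thesis
      using emeasure_alt_measure[of "space (alt_measure \<beta>)"] sets.top[of "alt_measure \<beta>"]
      unfolding sets_alt_measure space_alt_measure by (simp del: mem_Sigma_iff)
  qed
  also have "\<dots> = of_nat (length \<beta>) / of_nat (length \<beta>)"
    by (simp add: emeasure_space_invariant_measure)
  also have "\<dots> = 1"
    using length_pos by (intro ennreal_divide_self) (auto simp: of_nat_less_top)
  finally show ?thesis .
qed

lemma alt_map_eq: "alt_map \<beta> (i, x) = (Suc i mod length \<beta>, beta_comp \<beta> (int i) 1 x)"
  by (simp add: alt_map_def)

lemma alt_map_vimage:
  "{x. (i, x) \<in> alt_map \<beta> -` E \<inter> space (alt_measure \<beta>)}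
     = (if i < length \<beta>
        then beta_comp \<beta> (int i) 1 -` {x. (Suc i mod length \<beta>, x) \<in> E} \<inter> {0..<1} else {})"
  by (auto simp: alt_map_eq)

lemma alt_map_measurable: "alt_map \<beta> \<in> alt_measure \<beta> \<rightarrow>\<^sub>M alt_measure \<beta>"
proof (rule measurableI)
  show "alt_map \<beta> z \<in> space (alt_measure \<beta>)" if "z \<in> space (alt_measure \<beta>)" for z
    using that beta_comp_unit[of "snd z" \<beta> "int (fst z)" 1] length_pos
    by (cases z) (auto simp: alt_map_eq)
  fix E assume "E \<in> sets (alt_measure \<beta>)"
  then have "{x. (Suc i mod length \<beta>, x) \<in> E} \<in> sets unit_borel" for i
    using length_pos by (simp add: sets_alt_measure alt_algebra_iff)
  then show "alt_map \<beta> -` E \<inter> space (alt_measure \<beta>) \<in> sets (alt_measure \<beta>)"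
    unfolding sets_alt_measure alt_algebra_iff alt_map_vimage
    by (auto simp del: One_nat_def beta_comp.simps vimage_Collect_eq intro!: beta_comp_vimage)
qed

lemma sum_rotate: "(\<Sum>i<length \<beta>. f (Suc i mod length \<beta>)) = (\<Sum>i<length \<beta>. f i :: 'a :: comm_monoid_add)"
proof -
  obtain q where q: "length \<beta> = Suc q" using length_pos by (cases "length \<beta>") auto
  have "(\<Sum>i<Suc q. f (Suc i mod Suc q)) = (\<Sum>i<q. f (Suc i)) + f 0" by simp
  also have "\<dots> = (\<Sum>i<Suc q. f i)" by (simp only: sum.lessThan_Suc_shift add.commute)
  finally show ?thesis by (simp only: q)
qed

lemma int_Suc_mod: "int (Suc i) = int (Suc i mod length \<beta>) + int (Suc i div length \<beta> * length \<beta>)"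
  by (metis add.commute div_mult_mod_eq of_nat_add)

text \<open>The fibre map sends the component measure of \<open>i\<close> to that of
  \<open>i + 1\<close>, with wrap-around by periodicity, and the average over a full cycle does not
  change under this rotation.\<close>

lemma dynamical_system_alt_measure: "dynamical_system (alt_measure \<beta>) (alt_map \<beta>)"
  unfolding dynamical_system_def
proof (intro conjI emeasure_space_alt_measure alt_map_measurable)
  let ?M = "alt_measure \<beta>" and ?p = "length \<beta>"
  show "distr ?M ?M (alt_map \<beta>) = ?M"
  proof (rule measure_eqI)
    fix E assume "E \<in> sets (distr ?M ?M (alt_map \<beta>))"
    then have E: "E \<in> sets ?M" by simp
    have sec: "{x. (Suc i mod ?p, x) \<in> E} \<in> sets unit_borel" for i
      using E length_pos by (simp add: sets_alt_measure alt_algebra_iff)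
    have "emeasure (distr ?M ?M (alt_map \<beta>)) E
        = emeasure ?M (alt_map \<beta> -` E \<inter> space ?M)"
      by (rule emeasure_distr[OF alt_map_measurable E])
    also have "\<dots> = (\<Sum>i<?p. emeasure (invariant_measure (int i))
        {x. (i, x) \<in> alt_map \<beta> -` E \<inter> space ?M}) / of_nat ?p"
      using measurable_sets[OF alt_map_measurable E]
      by (intro emeasure_alt_measure) (simp add: sets_alt_measure)
    also have "(\<Sum>i<?p. emeasure (invariant_measure (int i))
        {x. (i, x) \<in> alt_map \<beta> -` E \<inter> space ?M})
        = (\<Sum>i<?p. emeasure (invariant_measure (int (Suc i mod ?p))) {x. (Suc i mod ?p, x) \<in> E})"
    proof (rule sum.cong[OF refl])
      fix i assume "i \<in> {..<?p}"
      then have "emeasure (invariant_measure (int i)) {x. (i, x) \<in> alt_map \<beta> -` E \<inter> space ?M}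
          = emeasure (distr (invariant_measure (int i)) unit_borel (beta_comp \<beta> (int i) 1))
              {x. (Suc i mod ?p, x) \<in> E}"
        using sec[of i] unfolding alt_map_vimage by (subst emeasure_distr) auto
      also have "distr (invariant_measure (int i)) unit_borel (beta_comp \<beta> (int i) 1)
          = invariant_measure (int (Suc i))"
        by (simp add: distr_invariant_measure add.commute)
      also have "\<dots> = invariant_measure (int (Suc i mod ?p))"
        unfolding int_Suc_mod[of i] by (rule invariant_measure_periodic)
      finally show "emeasure (invariant_measure (int i)) {x. (i, x) \<in> alt_map \<beta> -` E \<inter> space ?M}
          = emeasure (invariant_measure (int (Suc i mod ?p))) {x. (Suc i mod ?p, x) \<in> E}" .
    qed
    also have "\<dots> = (\<Sum>i<?p. emeasure (invariant_measure (int i)) {x. (i, x) \<in> E})"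
      by (rule sum_rotate)
    also have "\<dots> / of_nat ?p = emeasure ?M E"
      using E by (simp add: emeasure_alt_measure sets_alt_measure)
    finally show "emeasure (distr ?M ?M (alt_map \<beta>)) E = emeasure ?M E" .
  qed simp
qed

section \<open>Greedy expansions, shift spaces and the conjugacy\<close>

lemma base_at_base_shift: "base_at (base_shift \<beta> m) n = base_at \<beta> (m + n)"
proof -
  have "base_at (base_shift \<beta> m) n = base_at \<beta> (m + n mod int (length \<beta>))"
    using length_pos by (simp add: base_at_def[of "map _ _"] base_shift_def nat_less_iff)
  also have "\<dots> = base_at \<beta> (m + n)" by (simp add: base_at_def mod_add_right_eq)
  finally show ?thesis .
qed

lemma beta_comp_base_shift: "beta_comp (base_shift \<beta> m) k n x = beta_comp \<beta> (m + k) n x"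
  by (induction n) (simp_all add: base_at_base_shift add.assoc)

lemma greedy_base_shift:
  "greedy (base_shift \<beta> m) x n = \<lfloor>base_at \<beta> (m + int n) * beta_comp \<beta> m n x\<rfloor>"
  by (simp add: greedy_def base_at_base_shift beta_comp_base_shift)

text \<open>The source of the conjugacy: deleting the first digit corresponds to applying the first
  map and rotating the base by one.\<close>

lemma greedy_Suc:
  "greedy (base_shift \<beta> m) x (Suc n) = greedy (base_shift \<beta> (m + 1)) (beta_comp \<beta> m 1 x) n"
  using beta_comp_add[of \<beta> m 1 n x] by (simp add: greedy_base_shift ac_simps)

lemma base_shift_Suc_mod: "base_shift \<beta> (int (Suc i mod length \<beta>)) = base_shift \<beta> (int i + 1)"
proof -
  have "base_at \<beta> (int (Suc i mod length \<beta>) + k) = base_at \<beta> (int i + 1 + k)" for k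
    using base_at_periodic[of "int (Suc i mod length \<beta>) + k" "Suc i div length \<beta>"] int_Suc_mod[of i]
    by (simp add: algebra_simps)
  then show ?thesis by (simp add: base_shift_def)
qed

lemma alphabet_eq: "alphabet \<beta> = {0 .. Max (ceiling ` set \<beta>) - 1}"
proof -
  have "(\<lambda>i. \<lceil>\<beta> ! i\<rceil>) ` {..<length \<beta>} = ceiling ` set \<beta>"
    by (auto simp: set_conv_nth)
  then show ?thesis by (simp add: alphabet_def)
qed

lemma set_base_shift: "set (base_shift \<beta> m) = set \<beta>"
proof
  show "set (base_shift \<beta> m) \<subseteq> set \<beta>"
    using base_at_in by (auto simp: base_shift_def)
  show "set \<beta> \<subseteq> set (base_shift \<beta> m)"
  proof
    fix b assume "b \<in> set \<beta>"
    then obtain j where "j < length \<beta>" "b = \<beta> ! j" by (auto simp: in_set_conv_nth)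
    \<comment> \<open>An entry of the original base reappears at position \<open>int j - m\<close>,
      which may be negative and is read modulo the period.\<close>
    then have b: "b = base_at (base_shift \<beta> m) (int j - m)"
      by (simp add: base_at_base_shift) (simp add: base_at_def)
    have "nat ((int j - m) mod int (length \<beta>)) < length (base_shift \<beta> m)"
      using length_pos by (simp add: nat_less_iff)
    then show "b \<in> set (base_shift \<beta> m)"
      unfolding b base_at_def by (metis length_base_shift nth_mem)
  qed
qed

lemma alphabet_base_shift: "alphabet (base_shift \<beta> m) = alphabet \<beta>"
proof -
  interpret s: alternate_base "base_shift \<beta> m"
  proof
    show "base_shift \<beta> m \<noteq> []" using length_pos by (metis length_base_shift length_greater_0_conv)
  qed (simp add: set_base_shift gt_1)
  show ?thesis by (simp add: alphabet_eq s.alphabet_eq set_base_shift)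
qed

lemma greedy_in_alphabet:
  assumes "x \<in> {0..<1}"
  shows "greedy (base_shift \<beta> m) x n \<in> alphabet \<beta>"
proof -
  let ?b = "base_at \<beta> (m + int n)" and ?y = "beta_comp \<beta> m n x"
  have y: "0 \<le> ?y" "?y < 1" using beta_comp_unit[OF assms, of \<beta> m n] by auto
  have b: "0 < ?b" by (rule base_at_bounds(4))
  have "?b * ?y < ?b" using y b by simp
  then have "\<lfloor>?b * ?y\<rfloor> \<le> \<lceil>?b\<rceil> - 1" by linarith
  also have "\<lceil>?b\<rceil> \<le> Max (ceiling ` set \<beta>)"
    using base_at_in[of "m + int n"] by (intro Max_ge) auto
  finally show ?thesis using y b by (simp add: greedy_base_shift alphabet_eq)
qed

text \<open>\<open>closure_of\<close> stays inside the topological space, so the greedy set lies in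
  its closure only because its digits belong to the alphabet.\<close>

lemma greedy_in_beta_shift_space:
  assumes "x \<in> {0..<1}"
  shows "greedy (base_shift \<beta> m) x \<in> beta_shift_space (base_shift \<beta> m)"
proof -
  have "greedy_set (base_shift \<beta> m) \<subseteq> UNIV \<rightarrow> alphabet \<beta>"
    using greedy_in_alphabet by (auto simp: greedy_set_def)
  then have "greedy_set (base_shift \<beta> m) \<subseteq> beta_shift_space (base_shift \<beta> m)"
    unfolding beta_shift_space_def alphabet_base_shift
    by (intro closure_of_subset) (simp add: PiE_UNIV_domain)
  then show ?thesis using assms by (auto simp: greedy_set_def)
qed

lemma beta_shift_space_subset: "beta_shift_space (base_shift \<beta> m) \<subseteq> UNIV \<rightarrow> alphabet \<beta>"
proof -
  have "beta_shift_space (base_shift \<beta> m)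
      \<subseteq> topspace (product_topology (\<lambda>_. discrete_topology (alphabet \<beta>)) UNIV)"
    unfolding beta_shift_space_def alphabet_base_shift by (rule closure_of_subset_topspace)
  then show ?thesis by (simp add: PiE_UNIV_domain)
qed

text \<open>The shift is continuous, each of its components being a coordinate projection, and maps
  greedy expansions to greedy expansions for the next rotation; continuity carries this over to the
  closures.\<close>

lemma shift_in_beta_shift_space:
  assumes w: "w \<in> beta_shift_space (base_shift \<beta> m)"
  shows "(\<lambda>n. w (Suc n)) \<in> beta_shift_space (base_shift \<beta> (m + 1))"
proof -
  let ?X = "product_topology (\<lambda>_. discrete_topology (alphabet \<beta>)) (UNIV :: nat set)"
  let ?f = "\<lambda>w n. w (Suc n)"
  have "continuous_map ?X ?X ?f"
    unfolding continuous_map_componentwise_UNIV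
    by (intro allI continuous_map_product_projection UNIV_I)
  then have "?f ` (?X closure_of greedy_set (base_shift \<beta> m))
      \<subseteq> ?X closure_of ?f ` greedy_set (base_shift \<beta> m)"
    by (rule continuous_map_image_closure_subset)
  also have "\<dots> \<subseteq> ?X closure_of greedy_set (base_shift \<beta> (m + 1))"
  proof (rule closure_of_mono)
    show "?f ` greedy_set (base_shift \<beta> m) \<subseteq> greedy_set (base_shift \<beta> (m + 1))"
      unfolding greedy_set_def image_image greedy_Suc
      by (intro image_subsetI imageI beta_comp_unit)
  qed
  finally show ?thesis
    using w unfolding beta_shift_space_def alphabet_base_shift by blast
qed

abbreviation shift_algebra :: "(nat \<times> (nat \<Rightarrow> int)) measure" where
  "shift_algebra \<equiv> sigma (alt_shift_space \<beta>) (alt_shift_algebra \<beta>)"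

text \<open>It suffices to treat cylinders, which constrain finitely many digits, and each digit is
  the floor of a Borel function.\<close>

lemma greedy_measurable:
  "greedy (base_shift \<beta> m) \<in> unit_borel \<rightarrow>\<^sub>M
     sigma (UNIV \<rightarrow> alphabet \<beta>) (cylinder (alphabet \<beta>) ` lists (alphabet \<beta>))"
proof (rule measurable_measure_of[OF set_cylinder_subset])
  let ?g = "greedy (base_shift \<beta> m)"
  show "?g \<in> space unit_borel \<rightarrow> UNIV \<rightarrow> alphabet \<beta>"
    using greedy_in_alphabet by auto
  fix D assume "D \<in> cylinder (alphabet \<beta>) ` lists (alphabet \<beta>)"
  then obtain u where u: "D = cylinder (alphabet \<beta>) u" by auto
  have [measurable]: "(\<lambda>x. ?g x k) \<in> unit_borel \<rightarrow>\<^sub>M count_space UNIV" for k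
    unfolding greedy_base_shift unit_borel_def by (intro measurable_restrict_space1) measurable
  have "?g -` D \<inter> space unit_borel = {x \<in> space unit_borel. \<forall>k<length u. ?g x k = u ! k}"
    using greedy_in_alphabet by (auto simp: u cylinder_def)
  also have "\<dots> \<in> sets unit_borel" by measurable
  finally show "?g -` D \<inter> space unit_borel \<in> sets unit_borel" .
qed

lemma alt_psi_measurable: "alt_psi \<beta> \<in> alt_measure \<beta> \<rightarrow>\<^sub>M shift_algebra"
proof (rule measurable_measure_of[OF alt_shift_algebra_subset])
  show "alt_psi \<beta> \<in> space (alt_measure \<beta>) \<rightarrow> alt_shift_space \<beta>"
    using greedy_in_beta_shift_space by (auto simp: alt_psi_def alt_shift_space_def)
  fix E assume "E \<in> alt_shift_algebra \<beta>"
  then obtain C where C: "\<And>i. i < length \<beta> \<Longrightarrow> C i \<in> cylinder_algebra (alphabet \<beta>)"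
    "E = (\<Union>i<length \<beta>. {i} \<times> (C i \<inter> beta_shift_space (base_shift \<beta> (int i))))"
    by (auto simp: alt_shift_algebra_def)
  have "{x. (i, x) \<in> alt_psi \<beta> -` E \<inter> space (alt_measure \<beta>)}
      = greedy (base_shift \<beta> (int i)) -` C i \<inter> space unit_borel" if "i < length \<beta>" for i
    using that greedy_in_beta_shift_space by (auto simp: C(2) alt_psi_def)
  moreover have "greedy (base_shift \<beta> (int i)) -` C i \<inter> space unit_borel \<in> sets unit_borel"
    if "i < length \<beta>" for i
    using C(1)[OF that] set_cylinder_subset
    by (intro measurable_sets[OF greedy_measurable]) (simp add: cylinder_algebra_def)
  ultimately show "alt_psi \<beta> -` E \<inter> space (alt_measure \<beta>) \<in> sets (alt_measure \<beta>)"
    unfolding sets_alt_measure alt_algebra_iff by (intro conjI allI impI) (auto simp only:, auto)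
qed

lemma alt_shift_measurable: "alt_shift (length \<beta>) \<in> shift_algebra \<rightarrow>\<^sub>M shift_algebra"
proof (rule measurable_measure_of[OF alt_shift_algebra_subset])
  let ?p = "length \<beta>"
  have space: "space shift_algebra = alt_shift_space \<beta>" by (simp add: space_measure_of_conv)
  have shift: "(\<lambda>n. w (Suc n)) \<in> beta_shift_space (base_shift \<beta> (int (Suc i mod ?p)))"
    if "w \<in> beta_shift_space (base_shift \<beta> (int i))" for w i
    using shift_in_beta_shift_space[OF that] by (simp add: base_shift_Suc_mod)
  show "alt_shift ?p \<in> space shift_algebra \<rightarrow> alt_shift_space \<beta>"
    unfolding space using shift length_pos by (auto simp: alt_shift_space_def alt_shift_def)
  fix E assume "E \<in> alt_shift_algebra \<beta>"
  then obtain C where C: "\<And>i. i < ?p \<Longrightarrow> C i \<in> cylinder_algebra (alphabet \<beta>)"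
    "E = (\<Union>i<?p. {i} \<times> (C i \<inter> beta_shift_space (base_shift \<beta> (int i))))"
    by (auto simp: alt_shift_algebra_def)
  \<comment> \<open>A point over \<open>i\<close> moves to the fibre over
    \<open>Suc i mod ?p\<close>, hence the index of \<open>C\<close>; the shifted word lies in the
    next shift space by \<open>shift\<close>.\<close>
  let ?C = "\<lambda>i. {w \<in> UNIV \<rightarrow> alphabet \<beta>. (\<lambda>n. w (Suc n)) \<in> C (Suc i mod ?p)}"
  have "alt_shift ?p -` E \<inter> space shift_algebra
      = (\<Union>i<?p. {i} \<times> (?C i \<inter> beta_shift_space (base_shift \<beta> (int i))))"
  proof (intro equalityI subsetI)
    fix z assume "z \<in> alt_shift ?p -` E \<inter> space shift_algebra"
    moreover obtain i w where "z = (i, w)" by (cases z)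
    ultimately have "i < ?p" "w \<in> beta_shift_space (base_shift \<beta> (int i))"
      "(\<lambda>n. w (Suc n)) \<in> C (Suc i mod ?p)"
      unfolding space by (auto simp: C(2) alt_shift_space_def alt_shift_def)
    then show "z \<in> (\<Union>i<?p. {i} \<times> (?C i \<inter> beta_shift_space (base_shift \<beta> (int i))))"
      using beta_shift_space_subset \<open>z = (i, w)\<close> by blast
  next
    fix z assume "z \<in> (\<Union>i<?p. {i} \<times> (?C i \<inter> beta_shift_space (base_shift \<beta> (int i))))"
    then show "z \<in> alt_shift ?p -` E \<inter> space shift_algebra"
      unfolding space using shift length_pos
      by (cases z) (auto simp: C(2) alt_shift_space_def alt_shift_def)
  qed
  moreover have "?C i \<in> cylinder_algebra (alphabet \<beta>)" for i
    using length_pos C(1) by (intro shift_measurable_cylinder_algebra) (auto simp: alphabet_def)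
  ultimately have "alt_shift ?p -` E \<inter> space shift_algebra \<in> alt_shift_algebra \<beta>"
    unfolding alt_shift_algebra_def by (intro CollectI exI[of _ ?C] conjI) simp_all
  then show "alt_shift ?p -` E \<inter> space shift_algebra \<in> sets shift_algebra"
    by (simp add: sets_measure_of[OF alt_shift_algebra_subset] sigma_sets.Basic)
qed

lemma alt_psi_alt_map: "alt_psi \<beta> (alt_map \<beta> z) = alt_shift (length \<beta>) (alt_psi \<beta> z)"
proof (cases z)
  case (Pair i x)
  show ?thesis
    unfolding Pair alt_map_eq
    by (simp add: alt_psi_def alt_shift_def base_shift_Suc_mod greedy_Suc)
qed

text \<open>Along equal digits both orbits lie in the same branches, so their distance grows at least
  like \<open>lo ^ n\<close>, yet stays below \<open>1\<close>.\<close>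

lemma greedy_inj: "inj_on (greedy (base_shift \<beta> m)) {0..<1}"
proof (rule inj_onI, rule ccontr)
  fix x y :: real
  assume xy: "x \<in> {0..<1}" "y \<in> {0..<1}" "x \<noteq> y"
    and eq: "greedy (base_shift \<beta> m) x = greedy (base_shift \<beta> m) y"
  have grow: "lo ^ n * \<bar>x - y\<bar> \<le> \<bar>beta_comp \<beta> m n x - beta_comp \<beta> m n y\<bar>" for n
  proof (induction n)
    case (Suc n)
    let ?b = "base_at \<beta> (m + int n)"
    have "\<lfloor>?b * beta_comp \<beta> m n x\<rfloor> = \<lfloor>?b * beta_comp \<beta> m n y\<rfloor>"
      using fun_cong[OF eq, of n] by (simp add: greedy_base_shift)
    then have "beta_comp \<beta> m (Suc n) x - beta_comp \<beta> m (Suc n) y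
        = ?b * (beta_comp \<beta> m n x - beta_comp \<beta> m n y)"
      by (simp add: beta_map_def right_diff_distrib)
    then have "\<bar>beta_comp \<beta> m (Suc n) x - beta_comp \<beta> m (Suc n) y\<bar>
        = ?b * \<bar>beta_comp \<beta> m n x - beta_comp \<beta> m n y\<bar>"
      using base_at_bounds(4)[of "m + int n"] by (simp add: abs_mult)
    also have "\<dots> \<ge> lo * (lo ^ n * \<bar>x - y\<bar>)"
      using lo_gt_1 base_at_bounds(2,4) Suc by (intro mult_mono) (auto intro: less_imp_le)
    finally show ?case by simp
  qed simp
  obtain n where n: "1 / \<bar>x - y\<bar> < lo ^ n" using real_arch_pow[OF lo_gt_1] by blast
  then have "1 < lo ^ n * \<bar>x - y\<bar>" using xy(3) by (simp add: pos_divide_less_eq)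
  moreover have "\<bar>beta_comp \<beta> m n x - beta_comp \<beta> m n y\<bar> < 1"
    using beta_comp_unit[OF xy(1), of \<beta> m n] beta_comp_unit[OF xy(2), of \<beta> m n] by auto
  ultimately show False using grow[of n] by linarith
qed

lemma alt_psi_inj: "inj_on (alt_psi \<beta>) (space (alt_measure \<beta>))"
  using greedy_inj by (auto simp: alt_psi_def inj_on_def)

text \<open>The measure on the shift is a pushforward by definition, so its invariance follows from
  that of \<open>alt_measure \<beta>\<close> by moving the shift across
  \<open>alt_psi \<beta>\<close>. Injectivity and the conjugacy hold everywhere, and the exceptional
  null set is empty.\<close>

lemma isomorphic_via_alt_psi:
  "isomorphic_via (alt_psi \<beta>) (alt_measure \<beta>) (alt_map \<beta>)
     (alt_shift_measure \<beta>) (alt_shift (length \<beta>))"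
proof -
  let ?M = "alt_measure \<beta>" and ?N = "alt_shift_measure \<beta>" and ?S = "alt_shift (length \<beta>)"
  note N = alt_shift_measure_def[of \<beta>]
  have sets_N [simp]: "sets ?N = sets shift_algebra" by (simp add: N)
  have space_N [simp]: "space ?N = space shift_algebra" by (simp only: N space_distr)
  have psi: "alt_psi \<beta> \<in> ?M \<rightarrow>\<^sub>M ?N"
    using alt_psi_measurable by (simp cong: measurable_cong_sets)
  have S: "?S \<in> ?N \<rightarrow>\<^sub>M ?N"
    using alt_shift_measurable by (simp cong: measurable_cong_sets)
  \<comment> \<open>\<open>distr\<close> depends on its target only through space and sets, so
    \<open>?N\<close> itself may serve as target, as \<open>isomorphic_via\<close> demands.\<close>
  have N': "?N = distr ?M ?N (alt_psi \<beta>)"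
    unfolding N by (rule distr_cong) simp_all
  have "distr ?N ?N ?S = distr (distr ?M ?N (alt_psi \<beta>)) ?N ?S"
    using N' by simp
  also have "\<dots> = distr ?M ?N (?S \<circ> alt_psi \<beta>)"
    by (rule distr_distr[OF S psi])
  also have "?S \<circ> alt_psi \<beta> = alt_psi \<beta> \<circ> alt_map \<beta>"
    by (auto simp: alt_psi_alt_map)
  also have "distr ?M ?N (alt_psi \<beta> \<circ> alt_map \<beta>) = distr (distr ?M ?M (alt_map \<beta>)) ?N (alt_psi \<beta>)"
    by (rule distr_distr[OF psi alt_map_measurable, symmetric])
  also have "\<dots> = ?N"
    using dynamical_system_alt_measure N' by (simp add: dynamical_system_def)
  finally have inv: "distr ?N ?N ?S = ?N" .
  have "emeasure ?N (space ?N) = emeasure ?M (space ?M)"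
    using measurable_space[OF psi] sets.top[of ?N]
    by (subst (1) N', subst emeasure_distr[OF psi]) (auto intro!: arg_cong[of _ _ "emeasure ?M"])
  then have "dynamical_system ?N ?S"
    using S inv emeasure_space_alt_measure by (simp add: dynamical_system_def)
  then show ?thesis
    unfolding isomorphic_via_def
    using psi N' dynamical_system_alt_measure alt_psi_inj
    by (auto simp: alt_psi_alt_map intro!: bexI[of _ "{}"])
qed

end

theorem theorem35:
  fixes p :: nat and \<beta> :: "real list"
  assumes "p \<ge> 1"
    and "length \<beta> = p"
    and "\<forall>i<p. \<beta> ! i > 1"
  shows "isomorphic_via (alt_psi \<beta>)
           (alt_measure \<beta>) (alt_map \<beta>)
           (alt_shift_measure \<beta>) (alt_shift p)"
proof -
  interpret alternate_base \<beta>
    using assms by unfold_locales (auto simp: in_set_conv_nth)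
  show ?thesis using isomorphic_via_alt_psi assms(2) by simp
qed

end
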